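(* Let $(\Lambda,w,\mathscr{H},\varepsilon_w)$ be an input datum over $k$, where $\mathscr{H}$ is a central extension of $\Lambda_w$ by $\langle\zeta\rangle$ with commutator pairing $\langle\cdot,\cdot\rangle_w$. Let $\mathfrak{h}$ be the associated Lie algebra, $\widetilde w$ the lift of $w$ to $\mathfrak{h}$, and $\mathfrak{g}=\mathfrak{h}^{\widetilde w}$. Let $K$ be a field extension of $k$, and let $(\rho,V)$ be a representation of $\mathscr{H}$ over $K$ such that $\rho(\zeta)v=\zeta v$ for all $v\in V$. Let $\pi:\widetilde\Lambda=\Lambda\times_{\Lambda_w}\mathscr{H}\to\mathscr{H}$ be the canonical projection, and let $\tilde\rho:\mathfrak{g}\to\mathfrak{gl}(V)$ be the (well-defined) linear map with $\tilde\rho(Z_{\tilde\alpha})=\rho(\pi(\tilde\alpha))$ for all $\tilde\alpha\in\widetilde\Phi$. Then $\tilde\rho:\mathfrak{g}\to\mathfrak{gl}(V)$ is a Lie algebra homomorphism; i.e. $\tilde\rho$ defines a representation of $\mathfrak{g}$ on $V$.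
   Context: A lattice is a finitely generated free $\mathbb{Z}$-module $\Lambda$ with a symmetric positive-definite bilinear form $(\cdot,\cdot):\Lambda\times\Lambda\to\mathbb{Z}$; $\operatorname{Aut}(\Lambda)$ is the group of $\mathbb{Z}$-linear bijections preserving the form. $\Lambda$ is a simply laced root lattice if it is generated by its set of roots $\Phi=\{\alpha\in\Lambda : (\alpha,\alpha)=2\}$. For $\gamma\in\Lambda$, $\gamma^\vee\in\operatorname{Hom}(\Lambda,\mathbb{Z})$ is $\gamma^\vee(\alpha)=(\gamma,\alpha)$. An automorphism $w\in\operatorname{Aut}(\Lambda)$ is elliptic if the group of coinvariants $\Lambda_w=\Lambda/(1-w)\Lambda$ is finite. Setting: $\Lambda$ is a simply laced root lattice, $w$ an elliptic automorphism of $\Lambda$ of order $d$, $k$ a field of characteristic zero containing a primitive $d$th root of unity $\zeta$, and $1\to\langle\zeta\rangle\to\mathscr{H}\to\Lambda_w\to1$ a central extension with commutator pairing $\langle\cdot,\cdot\rangle:\Lambda_w\times\Lambda_w\to\langle\zeta\rangle$. Let $\widetilde\Lambda=\Lambda\times_{\Lambda_w}\mathscr{H}$, a central extension of $\Lambda$ by $\langle\zeta\rangle$; its commutator pairing on $\Lambda$ (the pullback of that on $\Lambda_w$) is also written $\langle\cdot,\cdot\rangle$. Let $\widetilde\Phi$ be the preimage of $\Phi$ in $\widetilde\Lambda$; for $\tilde\alpha\in\widetilde\Phi$ write $\alpha$ for its image in $\Phi$. The quadruple $(\Lambda,w,\mathscr{H},\varepsilon)$ is an input datum if $\varepsilon:\Lambda\times\Lambda\to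 k^\times$ is bilinear (multiplicative in each variable) and: (1) $\varepsilon(\alpha,\beta)/\varepsilon(\beta,\alpha)=-\langle\beta,\alpha\rangle$ whenever $(\alpha,\beta)=-1$; (2) $\varepsilon(w\alpha,w\beta)=\varepsilon(\alpha,\beta)$ for all $\alpha,\beta\in\Lambda$. Construction of $\mathfrak{h}$: $\mathfrak{t}=\operatorname{Hom}(\Lambda,k)$, spanned by $\{\alpha^\vee:\alpha\in\Phi\}$; $\mathfrak{l}$ is the $k$-vector space generated by symbols $X_{\tilde\alpha}$, $\tilde\alpha\in\widetilde\Phi$, modulo the relations $X_{\zeta\tilde\alpha}=\zeta X_{\tilde\alpha}$; $\mathfrak{h}=\mathfrak{t}\oplus\mathfrak{l}$. It is a Lie algebra under the $k$-bilinear bracket with $[\mathfrak{t},\mathfrak{t}]=0$, $[\alpha^\vee,X_{\tilde\beta}]=-[X_{\tilde\beta},\alpha^\vee]=(\alpha,\beta)X_{\tilde\beta}$, and $[X_{\tilde\alpha},X_{\tilde\beta}]=\varepsilon(\alpha,\beta)\,\tilde\alpha\tilde\beta\,\alpha^\vee$ if $\alpha+\beta=0$ (with $\tilde\alpha\tilde\beta\in\langle\zeta\rangle\subset k^\times$ a scalar), $\varepsilon(\alpha,\beta)X_{\tilde\alpha\tilde\beta}$ if $\alpha+\beta\in\Phi$, and $0$ otherwise. Lift of $w$: extend $w$ to $\widetilde\Lambda$ by $w(\lambda,h)=(w\lambda,h)$; then $\widetilde w\in\operatorname{Aut}(\mathfrak{h})$ is the order-$d$ Lie algebra automorphism with $\widetilde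 w(\alpha^\vee)=w(\alpha)^\vee$ and $\widetilde w(X_{\tilde\alpha})=X_{w(\tilde\alpha)}$. For $\tilde\alpha\in\widetilde\Phi$ let $Z_{\tilde\alpha}=X_{\tilde\alpha}+X_{w\tilde\alpha}+\dots+X_{w^{d-1}\tilde\alpha}$; these elements span $\mathfrak{g}=\mathfrak{h}^{\widetilde w}$, and satisfy $Z_{w^j\tilde\alpha}=Z_{\tilde\alpha}$ and $Z_{\zeta\tilde\alpha}=\zeta Z_{\tilde\alpha}$. Special pairings: $\langle\alpha,\beta\rangle_w=\zeta^{\sum_{j=1}^{d-1}j(w^j\alpha,\beta)}$ for $\alpha,\beta\in\Lambda$, which factors through an alternating pairing on $\Lambda_w\times\Lambda_w$; and $\varepsilon_w(\alpha,\beta)=\prod_{j=1}^{d-1}(1-\zeta^{-j})^{(w^j\alpha,\beta)}\in k^\times$. *)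

theory Defs
  imports "HOL-Algebra.Multiplicative_Group" "HOL-Algebra.Coset" "HOL-Library.Poly_Mapping"
begin

text \<open>
  Conventions. The lattice $\Lambda$ is the whole type \<open>'l\<close>; the characteristic-zero field $k$ is the
  type \<open>'k\<close>. The group $\langle\zeta\rangle$ is a subgroup of $k^\times$, and a central extension of
  $\Lambda_w$ by it is given by a group \<open>extgrp\<close>, the inclusion \<open>incl\<close> of $\langle\zeta\rangle$ and the
  projection \<open>proj\<close> onto $\Lambda_w$, whose elements are the cosets of $(1-w)\Lambda$ in $\Lambda$.
\<close>

record ('l, 'k, 'h) setup_data =
  zmul :: "int \<Rightarrow> 'l \<Rightarrow> 'l"
  form :: "'l \<Rightarrow> 'l \<Rightarrow> int"
  aut :: "'l \<Rightarrow> 'l"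
  zeta :: 'k
  extgrp :: "'h monoid"
  incl :: "'k \<Rightarrow> 'h"
  proj :: "'h \<Rightarrow> 'l set"

section \<open>Lattices, automorphisms and central extensions\<close>

definition integral_lattice :: "(int \<Rightarrow> 'l \<Rightarrow> 'l) \<Rightarrow> ('l::ab_group_add \<Rightarrow> 'l \<Rightarrow> int) \<Rightarrow> bool" where
  "integral_lattice s b \<longleftrightarrow>
     Modules.module s \<and>
     (\<exists>B. finite B \<and> \<not> Modules.module.dependent s B \<and> Modules.module.span s B = UNIV) \<and>
     (\<forall>x. Modules.module_hom s (*) (b x)) \<and>
     (\<forall>x y. b x y = b y x) \<and>
     (\<forall>x. x \<noteq> 0 \<longrightarrow> b x x > 0)"

definition roots :: "('l, 'k, 'h) setup_data \<Rightarrow> 'l set" where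
  "roots S = {\<alpha>. form S \<alpha> \<alpha> = 2}"

definition simply_laced_root_lattice :: "('l::ab_group_add, 'k, 'h) setup_data \<Rightarrow> bool" where
  "simply_laced_root_lattice S \<longleftrightarrow>
     integral_lattice (zmul S) (form S) \<and> Modules.module.span (zmul S) (roots S) = UNIV"

definition lattice_Aut :: "('l::ab_group_add, 'k, 'h) setup_data \<Rightarrow> ('l \<Rightarrow> 'l) monoid" where
  "lattice_Aut S =
     \<lparr>carrier = {f. Modules.module_hom (zmul S) (zmul S) f \<and> bij f \<and>
                    (\<forall>x y. form S (f x) (f y) = form S x y)},
      monoid.mult = (\<circ>), one = id\<rparr>"

definition additive_group :: "'l::ab_group_add monoid" where
  "additive_group = \<lparr>carrier = UNIV, monoid.mult = (+), one = 0\<rparr>"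

definition one_minus_w_image :: "('l::ab_group_add, 'k, 'h) setup_data \<Rightarrow> 'l set" where
  "one_minus_w_image S = (\<lambda>x. x - aut S x) ` UNIV"

definition coinvariants :: "('l::ab_group_add, 'k, 'h) setup_data \<Rightarrow> 'l set monoid" where
  "coinvariants S = additive_group Mod one_minus_w_image S"

definition coinv_class :: "('l::ab_group_add, 'k, 'h) setup_data \<Rightarrow> 'l \<Rightarrow> 'l set" where
  "coinv_class S x = one_minus_w_image S #>\<^bsub>additive_group\<^esub> x"

definition elliptic :: "('l::ab_group_add, 'k, 'h) setup_data \<Rightarrow> bool" where
  "elliptic S \<longleftrightarrow> aut S \<in> carrier (lattice_Aut S) \<and> finite (carrier (coinvariants S))"

definition ord_w :: "('l::ab_group_add, 'k, 'h) setup_data \<Rightarrow> nat" where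
  "ord_w S = group.ord (lattice_Aut S) (aut S)"

definition primitive_root_of_unity :: "nat \<Rightarrow> 'k::field \<Rightarrow> bool" where
  "primitive_root_of_unity n z \<longleftrightarrow> n > 0 \<and> z ^ n = 1 \<and> (\<forall>j. 0 < j \<and> j < n \<longrightarrow> z ^ j \<noteq> 1)"

definition mu :: "('l, 'k::field, 'h) setup_data \<Rightarrow> 'k monoid" where
  "mu S = \<lparr>carrier = {zeta S ^ i | i::nat. True}, monoid.mult = (*), one = 1\<rparr>"

definition central_extension ::
  "'a monoid \<Rightarrow> 'h monoid \<Rightarrow> 'q monoid \<Rightarrow> ('a \<Rightarrow> 'h) \<Rightarrow> ('h \<Rightarrow> 'q) \<Rightarrow> bool" where
  "central_extension A E Q i p \<longleftrightarrow>
     group E \<and>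
     i \<in> hom A E \<and> inj_on i (carrier A) \<and>
     p \<in> hom E Q \<and> p ` carrier E = carrier Q \<and>
     kernel E Q p = i ` carrier A \<and>
     (\<forall>a\<in>carrier A. \<forall>x\<in>carrier E. i a \<otimes>\<^bsub>E\<^esub> x = x \<otimes>\<^bsub>E\<^esub> i a)"

definition setting :: "('l::ab_group_add, 'k::field_char_0, 'h) setup_data \<Rightarrow> bool" where
  "setting S \<longleftrightarrow>
     simply_laced_root_lattice S \<and>
     elliptic S \<and>
     primitive_root_of_unity (ord_w S) (zeta S) \<and>
     central_extension (mu S) (extgrp S) (coinvariants S) (incl S) (proj S)"

definition commutator_pairing ::
  "('l, 'k::field, 'h) setup_data \<Rightarrow> 'l set \<Rightarrow> 'l set \<Rightarrow> 'k" where
  "commutator_pairing S a b =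
     (THE z. z \<in> carrier (mu S) \<and>
        (\<forall>x\<in>carrier (extgrp S). \<forall>y\<in>carrier (extgrp S). proj S x = a \<longrightarrow> proj S y = b \<longrightarrow>
           x \<otimes>\<^bsub>extgrp S\<^esub> y \<otimes>\<^bsub>extgrp S\<^esub> inv\<^bsub>extgrp S\<^esub> x \<otimes>\<^bsub>extgrp S\<^esub> inv\<^bsub>extgrp S\<^esub> y = incl S z))"

definition lattice_pairing ::
  "('l::ab_group_add, 'k::field, 'h) setup_data \<Rightarrow> 'l \<Rightarrow> 'l \<Rightarrow> 'k" where
  "lattice_pairing S \<alpha> \<beta> = commutator_pairing S (coinv_class S \<alpha>) (coinv_class S \<beta>)"

section \<open>Input data\<close>

definition input_datum ::
  "('l::ab_group_add, 'k::field_char_0, 'h) setup_data \<Rightarrow> ('l \<Rightarrow> 'l \<Rightarrow> 'k) \<Rightarrow> bool" where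
  "input_datum S \<epsilon> \<longleftrightarrow>
     setting S \<and>
     (\<forall>\<alpha> \<beta>. \<epsilon> \<alpha> \<beta> \<noteq> 0) \<and>
     (\<forall>\<alpha> \<alpha>' \<beta>. \<epsilon> (\<alpha> + \<alpha>') \<beta> = \<epsilon> \<alpha> \<beta> * \<epsilon> \<alpha>' \<beta>) \<and>
     (\<forall>\<alpha> \<beta> \<beta>'. \<epsilon> \<alpha> (\<beta> + \<beta>') = \<epsilon> \<alpha> \<beta> * \<epsilon> \<alpha> \<beta>') \<and>
     (\<forall>\<alpha> \<beta>. form S \<alpha> \<beta> = -1 \<longrightarrow> \<epsilon> \<alpha> \<beta> / \<epsilon> \<beta> \<alpha> = - lattice_pairing S \<beta> \<alpha>) \<and>
     (\<forall>\<alpha> \<beta>. \<epsilon> (aut S \<alpha>) (aut S \<beta>) = \<epsilon> \<alpha> \<beta>)"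

definition pairing_w ::
  "('l::ab_group_add, 'k::field, 'h) setup_data \<Rightarrow> 'l \<Rightarrow> 'l \<Rightarrow> 'k" where
  "pairing_w S \<alpha> \<beta> =
     zeta S powi (\<Sum>j = 1..ord_w S - 1. int j * form S ((aut S ^^ j) \<alpha>) \<beta>)"

definition eps_w :: "('l::ab_group_add, 'k::field, 'h) setup_data \<Rightarrow> 'l \<Rightarrow> 'l \<Rightarrow> 'k" where
  "eps_w S \<alpha> \<beta> =
     (\<Prod>j = 1..ord_w S - 1. (1 - zeta S powi (- int j)) powi form S ((aut S ^^ j) \<alpha>) \<beta>)"

section \<open>The extension of the lattice\<close>

definition tilde_lattice :: "('l::ab_group_add, 'k, 'h) setup_data \<Rightarrow> ('l \<times> 'h) monoid" where
  "tilde_lattice S =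
     (additive_group \<times>\<times> extgrp S)
       \<lparr>carrier := {(x, h). h \<in> carrier (extgrp S) \<and> coinv_class S x = proj S h}\<rparr>"

definition tilde_roots :: "('l::ab_group_add, 'k, 'h) setup_data \<Rightarrow> ('l \<times> 'h) set" where
  "tilde_roots S = {a \<in> carrier (tilde_lattice S). fst a \<in> roots S}"

definition tilde_incl :: "('l::ab_group_add, 'k, 'h) setup_data \<Rightarrow> 'k \<Rightarrow> 'l \<times> 'h" where
  "tilde_incl S z = (0, incl S z)"

definition tilde_scalar :: "('l, 'k::field, 'h) setup_data \<Rightarrow> 'l \<times> 'h \<Rightarrow> 'k" where
  \<comment> \<open>inverse of \<open>tilde_incl\<close>; meant for elements lying over $0 \in \Lambda$\<close>
  "tilde_scalar S a = the_inv_into (carrier (mu S)) (incl S) (snd a)"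

definition tilde_aut :: "('l, 'k, 'h) setup_data \<Rightarrow> 'l \<times> 'h \<Rightarrow> 'l \<times> 'h" where
  "tilde_aut S a = (aut S (fst a), snd a)"

section \<open>Lie algebras on explicit carriers\<close>

record ('k, 'a) lie_alg = "'a partial_object" +
  vadd :: "'a \<Rightarrow> 'a \<Rightarrow> 'a"
  vscale :: "'k \<Rightarrow> 'a \<Rightarrow> 'a"
  bracket :: "'a \<Rightarrow> 'a \<Rightarrow> 'a"

definition linear_map :: "('k, 'a) lie_alg \<Rightarrow> ('k, 'b) lie_alg \<Rightarrow> ('a \<Rightarrow> 'b) \<Rightarrow> bool" where
  "linear_map A B f \<longleftrightarrow>
     f \<in> carrier A \<rightarrow> carrier B \<and>
     (\<forall>x\<in>carrier A. \<forall>y\<in>carrier A. f (vadd A x y) = vadd B (f x) (f y)) \<and>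
     (\<forall>c. \<forall>x\<in>carrier A. f (vscale A c x) = vscale B c (f x))"

definition lie_hom :: "('k, 'a) lie_alg \<Rightarrow> ('k, 'b) lie_alg \<Rightarrow> ('a \<Rightarrow> 'b) \<Rightarrow> bool" where
  "lie_hom A B f \<longleftrightarrow>
     linear_map A B f \<and>
     (\<forall>x\<in>carrier A. \<forall>y\<in>carrier A. f (bracket A x y) = bracket B (f x) (f y))"

section \<open>The space spanned by the symbols $X_{\tilde\alpha}$\<close>

text \<open>
  $\mathfrak{l}$ is the quotient of the space of finite formal combinations of elements of
  $\widetilde\Phi$ by the span of the relations $X_{\zeta\tilde\alpha} - \zeta X_{\tilde\alpha}$;
  its elements are cosets, and $X_{\tilde\alpha}$ is the coset of \<open>Poly_Mapping.single a 1\<close>.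
\<close>

definition fscale :: "'k::field \<Rightarrow> ('a \<Rightarrow>\<^sub>0 'k) \<Rightarrow> ('a \<Rightarrow>\<^sub>0 'k)" where
  "fscale c = Poly_Mapping.map ((*) c)"

definition free_space :: "('l::ab_group_add, 'k::field, 'h) setup_data \<Rightarrow> ('l \<times> 'h \<Rightarrow>\<^sub>0 'k) set" where
  "free_space S = {f. Poly_Mapping.keys f \<subseteq> tilde_roots S}"

definition relations :: "('l::ab_group_add, 'k::field, 'h) setup_data \<Rightarrow> ('l \<times> 'h \<Rightarrow>\<^sub>0 'k) set" where
  "relations S =
     Modules.module.span fscale
       {Poly_Mapping.single (tilde_incl S (zeta S) \<otimes>\<^bsub>tilde_lattice S\<^esub> a) 1
          - fscale (zeta S) (Poly_Mapping.single a 1) | a. a \<in> tilde_roots S}"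

definition lclass ::
  "('l::ab_group_add, 'k::field, 'h) setup_data \<Rightarrow> ('l \<times> 'h \<Rightarrow>\<^sub>0 'k) \<Rightarrow> ('l \<times> 'h \<Rightarrow>\<^sub>0 'k) set" where
  "lclass S f = {g. g - f \<in> relations S}"

definition l_space :: "('l::ab_group_add, 'k::field, 'h) setup_data \<Rightarrow> ('l \<times> 'h \<Rightarrow>\<^sub>0 'k) set set" where
  "l_space S = lclass S ` free_space S"

definition lrep :: "('l \<times> 'h \<Rightarrow>\<^sub>0 'k) set \<Rightarrow> ('l \<times> 'h \<Rightarrow>\<^sub>0 'k::field)" where
  \<comment> \<open>a representative of a coset; the operations on cosets below do not depend on the choice\<close>
  "lrep A = (SOME f. f \<in> A)"

section \<open>The Lie algebras $\mathfrak{h}$ and $\mathfrak{g}$\<close>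

type_synonym ('l, 'k, 'h) h_elem = "('l \<Rightarrow> 'k) \<times> ('l \<times> 'h \<Rightarrow>\<^sub>0 'k) set"

definition t_space :: "('l::ab_group_add \<Rightarrow> 'k::field) set" where
  "t_space = {\<tau>. \<forall>x y. \<tau> (x + y) = \<tau> x + \<tau> y}"

definition dual_vec :: "('l, 'k::field, 'h) setup_data \<Rightarrow> 'l \<Rightarrow> 'l \<Rightarrow> 'k" where
  "dual_vec S \<gamma> = (\<lambda>\<alpha>. of_int (form S \<gamma> \<alpha>))"

text \<open>
  The bracket is the bilinear extension of the defining formulas. Since $\mathfrak{t}$ is spanned by the
  $\alpha^\vee$, the formula for $[\alpha^\vee, X_{\tilde\beta}]$ extends to
  $[\tau, X_{\tilde\beta}] = \tau(\beta) X_{\tilde\beta}$ for all $\tau\in\mathfrak{t}$.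
  \<open>bracket_t\<close> collects the terms $[X_{\tilde\alpha}, X_{\tilde\beta}]$ with $\alpha + \beta = 0$, and
  \<open>bracket_l\<close> those with $\alpha+\beta\in\Phi$.
\<close>

definition bracket_t ::
  "('l::ab_group_add, 'k::field, 'h) setup_data \<Rightarrow> ('l \<Rightarrow> 'l \<Rightarrow> 'k) \<Rightarrow>
   ('l \<times> 'h \<Rightarrow>\<^sub>0 'k) \<Rightarrow> ('l \<times> 'h \<Rightarrow>\<^sub>0 'k) \<Rightarrow> 'l \<Rightarrow> 'k" where
  "bracket_t S \<epsilon> f g = (\<lambda>\<gamma>.
     \<Sum>a\<in>Poly_Mapping.keys f. \<Sum>b\<in>Poly_Mapping.keys g.
       if fst a + fst b = 0
       then Poly_Mapping.lookup f a * Poly_Mapping.lookup g b *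
            (\<epsilon> (fst a) (fst b) * tilde_scalar S (a \<otimes>\<^bsub>tilde_lattice S\<^esub> b) * dual_vec S (fst a) \<gamma>)
       else 0)"

definition bracket_l ::
  "('l::ab_group_add, 'k::field, 'h) setup_data \<Rightarrow> ('l \<Rightarrow> 'l \<Rightarrow> 'k) \<Rightarrow>
   ('l \<times> 'h \<Rightarrow>\<^sub>0 'k) \<Rightarrow> ('l \<times> 'h \<Rightarrow>\<^sub>0 'k) \<Rightarrow> ('l \<times> 'h \<Rightarrow>\<^sub>0 'k)" where
  "bracket_l S \<epsilon> f g =
     (\<Sum>a\<in>Poly_Mapping.keys f. \<Sum>b\<in>Poly_Mapping.keys g.
       if fst a + fst b \<in> roots S
       then fscale (Poly_Mapping.lookup f a * Poly_Mapping.lookup g b * \<epsilon> (fst a) (fst b))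
              (Poly_Mapping.single (a \<otimes>\<^bsub>tilde_lattice S\<^esub> b) 1)
       else 0)"

definition t_action :: "('l \<Rightarrow> 'k::field) \<Rightarrow> ('l \<times> 'h \<Rightarrow>\<^sub>0 'k) \<Rightarrow> ('l \<times> 'h \<Rightarrow>\<^sub>0 'k)" where
  "t_action \<tau> f =
     (\<Sum>a\<in>Poly_Mapping.keys f.
        fscale (\<tau> (fst a) * Poly_Mapping.lookup f a) (Poly_Mapping.single a 1))"

definition h_alg ::
  "('l::ab_group_add, 'k::field, 'h) setup_data \<Rightarrow> ('l \<Rightarrow> 'l \<Rightarrow> 'k) \<Rightarrow>
   ('k, ('l, 'k, 'h) h_elem) lie_alg" where
  "h_alg S \<epsilon> =
     \<lparr>carrier = t_space \<times> l_space S,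
      vadd = (\<lambda>(\<sigma>, A) (\<tau>, B). (\<lambda>\<gamma>. \<sigma> \<gamma> + \<tau> \<gamma>, lclass S (lrep A + lrep B))),
      vscale = (\<lambda>c (\<sigma>, A). (\<lambda>\<gamma>. c * \<sigma> \<gamma>, lclass S (fscale c (lrep A)))),
      bracket = (\<lambda>(\<sigma>, A) (\<tau>, B).
        (bracket_t S \<epsilon> (lrep A) (lrep B),
         lclass S (t_action \<sigma> (lrep B) - t_action \<tau> (lrep A) + bracket_l S \<epsilon> (lrep A) (lrep B))))\<rparr>"

definition push_forward :: "('a \<Rightarrow> 'a) \<Rightarrow> ('a \<Rightarrow>\<^sub>0 'k::field) \<Rightarrow> ('a \<Rightarrow>\<^sub>0 'k)" where
  "push_forward u f =
     (\<Sum>a\<in>Poly_Mapping.keys f. fscale (Poly_Mapping.lookup f a) (Poly_Mapping.single (u a) 1))"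

definition w_lift ::
  "('l::ab_group_add, 'k::field, 'h) setup_data \<Rightarrow> ('l, 'k, 'h) h_elem \<Rightarrow> ('l, 'k, 'h) h_elem" where
  \<comment> \<open>on $\mathfrak{t}$: $w(\alpha)^\vee = \alpha^\vee \circ w^{-1}$, as $w$ preserves the form\<close>
  "w_lift S = (\<lambda>(\<tau>, A). (\<tau> \<circ> Hilbert_Choice.inv (aut S), lclass S (push_forward (tilde_aut S) (lrep A))))"

definition g_alg ::
  "('l::ab_group_add, 'k::field, 'h) setup_data \<Rightarrow> ('l \<Rightarrow> 'l \<Rightarrow> 'k) \<Rightarrow>
   ('k, ('l, 'k, 'h) h_elem) lie_alg" where
  "g_alg S \<epsilon> = (h_alg S \<epsilon>)\<lparr>carrier := {x \<in> carrier (h_alg S \<epsilon>). w_lift S x = x}\<rparr>"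

definition Z_elem ::
  "('l::ab_group_add, 'k::field, 'h) setup_data \<Rightarrow> 'l \<times> 'h \<Rightarrow> ('l, 'k, 'h) h_elem" where
  \<comment> \<open>the sum of the cosets $X_{w^j\tilde\alpha}$ is the coset of the sum of representatives\<close>
  "Z_elem S a =
     (\<lambda>_. 0, lclass S (\<Sum>j<ord_w S. Poly_Mapping.single ((tilde_aut S ^^ j) a) 1))"

section \<open>Field extensions and representations\<close>

definition field_embedding :: "('k::field \<Rightarrow> 'K::field) \<Rightarrow> bool" where
  "field_embedding e \<longleftrightarrow>
     e 1 = 1 \<and> (\<forall>x y. e (x + y) = e x + e y) \<and> (\<forall>x y. e (x * y) = e x * e y)"

definition general_linear_group :: "('K::field \<Rightarrow> 'v::ab_group_add \<Rightarrow> 'v) \<Rightarrow> ('v \<Rightarrow> 'v) monoid" where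
  "general_linear_group s =
     \<lparr>carrier = {f. Vector_Spaces.linear s s f \<and> bij f}, monoid.mult = (\<circ>), one = id\<rparr>"

text \<open>$\mathfrak{gl}(V)$ for a $K$-vector space $V$, as a Lie algebra over $k$ along \<open>e\<close>.\<close>

definition gl_alg ::
  "('k::field \<Rightarrow> 'K::field) \<Rightarrow> ('K \<Rightarrow> 'v::ab_group_add \<Rightarrow> 'v) \<Rightarrow> ('k, 'v \<Rightarrow> 'v) lie_alg" where
  "gl_alg e s =
     \<lparr>carrier = {f. Vector_Spaces.linear s s f},
      vadd = (\<lambda>f g v. f v + g v),
      vscale = (\<lambda>c f v. s (e c) (f v)),
      bracket = (\<lambda>f g v. f (g v) - g (f v))\<rparr>"

text \<open>
  Being \<open>rho_tilde_map\<close> says that \<open>r\<close> is the linear map $\mathfrak{g}\to\mathfrak{gl}(V)$ with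
  $Z_{\tilde\alpha}\mapsto\rho(\pi(\tilde\alpha))$, where $\pi$ is \<open>snd\<close>; maps with domain $\mathfrak{g}$
  are made unique as functions by \<open>extensional\<close>.
\<close>

definition rho_tilde_map ::
  "('l::ab_group_add, 'k::field, 'h) setup_data \<Rightarrow> ('l \<Rightarrow> 'l \<Rightarrow> 'k) \<Rightarrow> ('k \<Rightarrow> 'K::field) \<Rightarrow>
   ('K \<Rightarrow> 'v::ab_group_add \<Rightarrow> 'v) \<Rightarrow> ('h \<Rightarrow> 'v \<Rightarrow> 'v) \<Rightarrow>
   (('l, 'k, 'h) h_elem \<Rightarrow> 'v \<Rightarrow> 'v) \<Rightarrow> bool" where
  "rho_tilde_map S \<epsilon> e s \<rho> r \<longleftrightarrow>
     r \<in> extensional (carrier (g_alg S \<epsilon>)) \<and>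
     linear_map (g_alg S \<epsilon>) (gl_alg e s) r \<and>
     (\<forall>a\<in>tilde_roots S. r (Z_elem S a) = \<rho> (snd a))"

end

theory Submission
  imports Defs "HOL-Computational_Algebra.Polynomial"
begin

text \<open>
  Let \<open>a\<close>, \<open>b\<close> be roots. On the generators attached to lifts of \<open>a\<close> and \<open>b\<close>, compatibility with
  brackets is the scalar identity
  \[ \sum_{j<d,\ (w^j a,b)=-1} \varepsilon_w(w^j a, b) = 1 - \langle b, a\rangle_w . \]
  Put $m_j=(w^j a,b)$ and $y_j=\zeta^{-j}$; since $w$ is elliptic, $\sum_j m_j=0$. If $b$ is not in the
  orbit of $-a$, then all $m_j\ge -1$ and the summands are the partial fraction coefficients of
  $F(x)=\prod_j(1-y_jx)^{m_j}$, so that their sum is $F(0)-F(\infty)$. If $b=-w^ia$, then the terms with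
  indices $j$ and $2i-j$ cancel by the first axiom of an input datum, and $\langle b,a\rangle_w=1$.

  The map itself sends the class of a $w$-invariant combination $\sum_a f_a X_a$ to
  $\frac1d\sum_a f_a\,\rho(\pi(a))$. The component of $\mathfrak{g}$ in $\mathfrak{t}$ vanishes because
  $\sum_j w^j=0$.
\<close>

section \<open>Partial fractions with simple poles\<close>

text \<open>In the product defining \<open>eps_w\<close> at (w^i a, b), the substitution j = l + i
  modulo d produces the factors (1 - y_j/y_i)^(m_j) for j other than i: this is F without its factor
  of index i, evaluated at 1/y_i. The values of the special form along an orbit are thus residue
  data of one rational function. The orbit of -a needs its own argument because m_i = -2 there gives
  a double pole. Passing from generators to the algebra meets two obstacles. The bracket is computed
  on arbitrarily chosen representatives of cosets, so identities have to be stable modulo the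
  relations, and a representative of an invariant class is invariant only modulo them. Moreover the
  elements Z satisfy linear relations, so prescribing values on them does not by itself define a
  map; the averaging formula supplies one directly, and it is forced since every invariant class is
  the orbit sum of one of its representatives divided by d.\<close>

lemma poly_eq_0_if_many_roots:
  fixes q :: "'a::idom poly"
  assumes "finite A" "\<And>x. x \<in> A \<Longrightarrow> poly q x = 0" "degree q \<le> card A" "coeff q (card A) = 0"
  shows "q = 0"
proof (rule ccontr)
  assume q: "q \<noteq> 0"
  have "card A \<le> card {x. poly q x = 0}"
    using assms q by (intro card_mono poly_roots_finite) auto
  also have "\<dots> \<le> degree q" using q by (rule card_poly_roots_bound)
  finally have "degree q = card A" using assms(3) by simp
  then show False using assms(4) q by (metis leading_coeff_0_iff)
qed

lemma coeff_mult_sum: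
  fixes p q :: "'a::comm_semiring_0 poly"
  assumes "degree p \<le> m" "degree q \<le> n"
  shows "coeff (p * q) (m + n) = coeff p m * coeff q n"
proof -
  have "coeff p i * coeff q (m + n - i) = 0" if "i \<noteq> m" "i \<le> m + n" for i
    using assms that coeff_eq_0[of p i] coeff_eq_0[of q "m + n - i"] by (cases "i < m") auto
  then have "coeff (p * q) (m + n) = (\<Sum>i\<le>m + n. if i = m then coeff p m * coeff q n else 0)"
    unfolding coeff_mult by (intro sum.cong) auto
  then show ?thesis by simp
qed

text \<open>The coefficient in the formal degree plays the role of the value at infinity. It
  vanishes if some y_j with positive exponent is zero, so only a bound on the degree is
  claimed.\<close>

lemma degree_coeff_prod_linear:
  fixes y :: "'i \<Rightarrow> 'a::idom"
  assumes "finite I"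
  shows "degree (\<Prod>j\<in>I. [:1, - y j:] ^ m j) \<le> (\<Sum>j\<in>I. m j) \<and>
         coeff (\<Prod>j\<in>I. [:1, - y j:] ^ m j) (\<Sum>j\<in>I. m j) = (\<Prod>j\<in>I. (- y j) ^ m j)"
  using assms
proof (induction rule: finite_induct)
  case (insert i I)
  let ?p = "[:1, - y i:] ^ m i" and ?q = "\<Prod>j\<in>I. [:1, - y j:] ^ m j"
  have p: "degree ?p \<le> m i \<and> coeff ?p (m i) = (- y i) ^ m i"
  \<comment> \<open>The exponent is a value of \<open>m\<close>; generalising \<open>m\<close>
    allows the induction hypothesis to be used for the constant function with value
    \<open>n\<close>.\<close>
  proof (induction "m i" arbitrary: m)
    case (Suc n)
    have IH: "degree ([:1, - y i:] ^ n) \<le> n" "coeff ([:1, - y i:] ^ n) n = (- y i) ^ n"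
      using Suc(1)[of "\<lambda>_. n"] by auto
    have "degree ([:1, - y i:] * [:1, - y i:] ^ n) \<le> 1 + n"
      by (rule order_trans[OF degree_mult_le]) (use IH in auto)
    moreover have "coeff ([:1, - y i:] ^ n) (Suc n) = 0"
      using IH(1) by (intro coeff_eq_0) auto
    ultimately show ?case using IH(2) unfolding Suc(2)[symmetric] by simp
  qed simp
  have "degree (?p * ?q) \<le> m i + (\<Sum>j\<in>I. m j)"
    by (rule order_trans[OF degree_mult_le]) (use p insert in \<open>auto intro: add_mono\<close>)
  moreover have "coeff (?p * ?q) (m i + (\<Sum>j\<in>I. m j)) = coeff ?p (m i) * coeff ?q (\<Sum>j\<in>I. m j)"
    using p insert by (intro coeff_mult_sum) auto
  ultimately show ?case using insert p by simp
qed simp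

text \<open>Write F = N/D with the simple poles collected in D, and let r_i be the summands on the
  left. The polynomial \<open>q\<close> is D times F - c - (sum of r_i/(1 - y_i x)), where c is the
  value of F at infinity. It vanishes at the points 1/y_i, of which there are \<open>card P\<close>,
  and its coefficient of degree \<open>card P\<close> vanishes by the choice of c, like one more
  root at infinity. Since its degree is at most \<open>card P\<close>, it is zero; the claim is its
  value at 0.\<close>

lemma sum_residues_simple_poles:
  fixes y :: "'i \<Rightarrow> 'a::field" and m :: "'i \<Rightarrow> int"
  assumes fin: "finite I" and inj: "inj_on y I" and y0: "\<And>i. i \<in> I \<Longrightarrow> y i \<noteq> 0"
    and m: "\<And>i. i \<in> I \<Longrightarrow> m i \<ge> -1" and sum0: "(\<Sum>i\<in>I. m i) = 0"
  shows "(\<Sum>i | i \<in> I \<and> m i = -1. \<Prod>j\<in>I - {i}. (1 - y j / y i) powi m j) =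
         1 - (\<Prod>i\<in>I. (- y i) powi m i)"
proof -
  define P where "P = {i \<in> I. m i = -1}"
  define Q where "Q = {i \<in> I. m i \<noteq> -1}"
  have fP: "finite P" "finite Q" and IPQ: "I = P \<union> Q" "P \<inter> Q = {}"
    using fin by (auto simp: P_def Q_def)
  have mQ: "m j = int (nat (m j))" if "j \<in> Q" for j using that m[of j] by (auto simp: Q_def)
  have mP: "m j = -1" if "j \<in> P" for j using that by (auto simp: P_def)
  define N where "N = (\<Prod>j\<in>Q. [:1, - y j:] ^ nat (m j))"
  define D where "D = (\<Prod>j\<in>P. [:1, - y j:])"
  define c where "c = (\<Prod>i\<in>I. (- y i) powi m i)"
  define r where "r i = (\<Prod>j\<in>I - {i}. (1 - y j / y i) powi m j)" for i
  \<comment> \<open>The total exponent being zero, N and D have the same formal degree, so that F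
    has a finite value at infinity.\<close>
  have "(\<Sum>i\<in>P. m i) + (\<Sum>i\<in>Q. m i) = 0"
    using sum0 fP IPQ by (simp add: sum.union_disjoint)
  moreover have "(\<Sum>i\<in>Q. m i) = int (\<Sum>i\<in>Q. nat (m i))"
    unfolding of_nat_sum by (intro sum.cong refl mQ)
  moreover have "(\<Sum>i\<in>P. m i) = - int (card P)" using mP by simp
  ultimately have n: "(\<Sum>i\<in>Q. nat (m i)) = card P" by linarith
  have N: "degree N \<le> card P" "coeff N (card P) = (\<Prod>j\<in>Q. (- y j) ^ nat (m j))"
    using degree_coeff_prod_linear[OF fP(2), of y "\<lambda>j. nat (m j)"] n by (auto simp: N_def)
  have D: "degree D \<le> card P" "coeff D (card P) = (\<Prod>j\<in>P. - y j)"
    using degree_coeff_prod_linear[OF fP(1), of y "\<lambda>_. 1"] by (auto simp: D_def)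
  have Di: "degree (\<Prod>j\<in>P - {i}. [:1, - y j:]) \<le> card P - 1" if "i \<in> P" for i
    using degree_coeff_prod_linear[of "P - {i}" y "\<lambda>_. 1"] fP that by (auto simp: card_Diff_singleton)
  have c: "c = (\<Prod>j\<in>Q. (- y j) ^ nat (m j)) / (\<Prod>j\<in>P. - y j)"
  proof -
    have "c = (\<Prod>j\<in>P. (- y j) powi m j) * (\<Prod>j\<in>Q. (- y j) powi m j)"
      using fP IPQ by (simp add: c_def prod.union_disjoint)
    moreover have "(\<Prod>j\<in>P. (- y j) powi m j) = inverse (\<Prod>j\<in>P. - y j)"
      using mP by (simp add: prod_inversef[symmetric] power_int_minus o_def)
    moreover have "(\<Prod>j\<in>Q. (- y j) powi m j) = (\<Prod>j\<in>Q. (- y j) ^ nat (m j))"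
      by (intro prod.cong) (metis mQ power_int_of_nat)+
    ultimately show ?thesis by (simp add: field_simps)
  qed
  have D0: "(\<Prod>j\<in>P. - y j) \<noteq> 0" using y0 fP by (auto simp: P_def)
  define q where "q = N - smult c D - (\<Sum>i\<in>P. smult (r i) (\<Prod>j\<in>P - {i}. [:1, - y j:]))"
  have "q = 0"
  proof (rule poly_eq_0_if_many_roots)
    let ?A = "(\<lambda>i. 1 / y i) ` P"
    have card: "card ?A = card P"
      using inj y0 by (intro card_image) (auto simp: inj_on_def P_def)
    show "finite ?A" using fP by simp
    show "degree q \<le> card ?A" unfolding card q_def
      by (intro degree_diff_le degree_sum_le order_trans[OF degree_smult_le] N D fP)
         (use Di in fastforce)
    have "coeff (\<Prod>j\<in>P - {i}. [:1, - y j:]) (card P) = 0" if "i \<in> P" for i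
      using Di[OF that] that fP by (intro coeff_eq_0) (metis One_nat_def Suc_pred card_gt_0_iff empty_iff le_imp_less_Suc)
    then show "coeff q (card ?A) = 0"
      unfolding card q_def using N D c D0 by (simp add: coeff_sum)
    fix x assume "x \<in> ?A"
    then obtain i where i: "i \<in> P" "x = 1 / y i" by auto
    have yi: "y i \<noteq> 0" using i y0 by (auto simp: P_def)
    have D0: "poly D x = 0"
      using i fP yi by (auto simp: D_def poly_prod)
    have S: "(\<Sum>k\<in>P. r k * (\<Prod>j\<in>P - {k}. poly [:1, - y j:] x)) = r i * (\<Prod>j\<in>P - {i}. 1 - y j / y i)"
    proof -
      have "(\<Prod>j\<in>P - {k}. poly [:1, - y j:] x) = 0" if "k \<in> P" "k \<noteq> i" for k
        using i fP yi that by (intro prod_zero bexI[of _ i]) auto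
      then have "(\<Sum>k\<in>P. r k * (\<Prod>j\<in>P - {k}. poly [:1, - y j:] x))
          = (\<Sum>k\<in>P. if k = i then r i * (\<Prod>j\<in>P - {i}. poly [:1, - y j:] x) else 0)"
        by (intro sum.cong) auto
      then show ?thesis using i fP by simp
    qed
    have nz: "1 - y j / y i \<noteq> 0" if "j \<in> P - {i}" for j
      using that inj yi i by (auto simp: inj_on_def P_def)
    have "I - {i} = (P - {i}) \<union> Q" "(P - {i}) \<inter> Q = {}" using i IPQ by auto
    \<comment> \<open>The indices in \<open>P\<close> contribute the inverse of the denominator
      without its vanishing factor, those in \<open>Q\<close> contribute N(x). Hence
      \<open>r i\<close> is exactly the coefficient that makes \<open>q\<close> vanish at x.\<close>
    then have "r i = (\<Prod>j\<in>P - {i}. (1 - y j / y i) powi m j) * (\<Prod>j\<in>Q. (1 - y j / y i) powi m j)"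
      using fP by (simp add: r_def prod.union_disjoint)
    moreover have "(\<Prod>j\<in>P - {i}. (1 - y j / y i) powi m j) = inverse (\<Prod>j\<in>P - {i}. 1 - y j / y i)"
      using mP by (simp add: prod_inversef[symmetric] power_int_minus o_def)
    moreover have "(\<Prod>j\<in>Q. (1 - y j / y i) powi m j) = poly N x"
      unfolding N_def poly_prod poly_power i
    proof (intro prod.cong refl)
      fix j assume j: "j \<in> Q"
      show "(1 - y j / y i) powi m j = poly [:1, - y j:] (1 / y i) ^ nat (m j)"
        by (subst mQ[OF j]) (simp del: int_nat_eq)
    qed
    moreover have "(\<Prod>j\<in>P - {i}. 1 - y j / y i) \<noteq> 0" using nz fP by (simp only: prod_zero_iff finite_Diff) blast
    ultimately have "poly N x = r i * (\<Prod>j\<in>P - {i}. 1 - y j / y i)" by simp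
    then show "poly q x = 0"
      using D0 S by (simp add: q_def poly_sum poly_prod)
  qed
  then have "poly q 0 = 0" by simp
  then have "1 - c - (\<Sum>i\<in>P. r i) = 0"
    by (simp add: q_def poly_sum poly_prod N_def D_def)
  then show ?thesis by (simp add: r_def c_def P_def)
qed

section \<open>Elliptic automorphisms and the commutator pairing\<close>

locale elliptic_setting =
  fixes S :: "('l::ab_group_add, 'k::field_char_0, 'h) setup_data"
  assumes setting: "setting S"
begin

abbreviation "w \<equiv> aut S"
abbreviation "B \<equiv> form S"
abbreviation "d \<equiv> ord_w S"
abbreviation "H \<equiv> extgrp S"
abbreviation "cls \<equiv> coinv_class S"

lemma integral_lattice: "integral_lattice (zmul S) B"
  using setting by (simp add: setting_def simply_laced_root_lattice_def)

lemma module_zmul: "Modules.module (zmul S)"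
  using integral_lattice by (simp add: integral_lattice_def)

lemma form_sym: "B x y = B y x"
  using integral_lattice by (simp add: integral_lattice_def)

lemma form_pos: "x \<noteq> 0 \<Longrightarrow> B x x > 0"
  using integral_lattice by (simp add: integral_lattice_def)

lemma module_hom_form: "Modules.module_hom (zmul S) (*) (B x)"
  using integral_lattice by (simp add: integral_lattice_def)

lemma form_add_right: "B x (y + z) = B x y + B x z"
  by (rule module_hom.add[OF module_hom_form])

lemma form_add_left: "B (x + y) z = B x z + B y z"
  by (metis form_add_right form_sym)

lemma form_0 [simp]: "B 0 x = 0" "B x 0 = 0"
  using form_add_left[of 0 0] form_add_right[of _ 0 0] by auto

lemma form_minus_left [simp]: "B (- x) y = - B x y"
  using form_add_left[of x "- x" y] by simp

lemma form_minus_right [simp]: "B x (- y) = - B x y"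
  by (metis form_minus_left form_sym)

lemma form_diff_left: "B (x - y) z = B x z - B y z"
  by (metis (no_types) diff_conv_add_uminus form_add_left form_minus_left)

lemma form_zmul_left: "B (zmul S n x) y = n * B x y"
  by (metis form_sym module_hom.scale[OF module_hom_form])

lemma form_sum_left: "B (\<Sum>i\<in>I. f i) y = (\<Sum>i\<in>I. B (f i) y)"
  by (induction I rule: infinite_finite_induct) (auto simp: form_add_left)

lemma aut_in_lattice_Aut: "w \<in> carrier (lattice_Aut S)"
  using setting by (simp add: setting_def elliptic_def)

lemma bij_aut: "bij w" and form_aut [simp]: "B (w x) (w y) = B x y"
  and aut_add: "w (x + y) = w x + w y"
  using aut_in_lattice_Aut module_hom.add by (auto simp: lattice_Aut_def)

lemma aut_0 [simp]: "w 0 = 0"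
  using aut_add[of 0 0] by simp

lemma aut_minus: "w (- x) = - w x"
  using aut_add[of x "- x"] by (simp add: eq_neg_iff_add_eq_0 add.commute)

lemma aut_sum: "w (\<Sum>i\<in>I. f i) = (\<Sum>i\<in>I. w (f i))"
  by (induction I rule: infinite_finite_induct) (auto simp: aut_add)

lemma form_funpow_aut [simp]: "B ((w ^^ n) x) ((w ^^ n) y) = B x y"
  by (induction n) auto

text \<open>\<open>ord_w\<close> is an order in this monoid; the group structure is what turns it
  into the equation w^d = id.\<close>

lemma group_lattice_Aut: "group (lattice_Aut S)"
proof (rule groupI)
  fix f assume f: "f \<in> carrier (lattice_Aut S)"
  let ?g = "Hilbert_Choice.inv f"
  have bij: "bij f" and hom: "Modules.module_hom (zmul S) (zmul S) f"
    and iso: "\<And>x y. B (f x) (f y) = B x y"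
    using f by (auto simp: lattice_Aut_def)
  have fg: "f (?g x) = x" and gf: "?g (f x) = x" for x
    using bij by (auto simp: bij_is_surj surj_f_inv_f bij_is_inj inv_f_f)
  have "Modules.module_hom (zmul S) (zmul S) ?g"
  proof (intro module_hom.intro module_zmul module_hom_axioms.intro)
    fix x y
    show "?g (x + y) = ?g x + ?g y"
      using module_hom.add[OF hom, of "?g x" "?g y"] by (metis fg gf)
    fix c
    show "?g (zmul S c x) = zmul S c (?g x)"
      using module_hom.scale[OF hom, of c "?g x"] by (metis fg gf)
  qed
  moreover have "B (?g x) (?g y) = B x y" for x y by (metis fg iso)
  ultimately show "\<exists>g\<in>carrier (lattice_Aut S). g \<otimes>\<^bsub>lattice_Aut S\<^esub> f = \<one>\<^bsub>lattice_Aut S\<^esub>"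
    using bij by (intro bexI[of _ ?g]) (auto simp: lattice_Aut_def gf fun_eq_iff bij_imp_bij_inv)
qed (auto simp: lattice_Aut_def o_assoc module.module_hom_id[OF module_zmul]
          intro: bij_comp module_hom_compose)

text \<open>An automorphism of infinite order would have \<open>ord_w\<close> equal to 0; positivity
  is read off from the definition of a primitive root of unity.\<close>

lemma order_pos: "d > 0" and zeta_pow_order: "zeta S ^ d = 1"
  and zeta_primitive: "\<And>j. 0 < j \<Longrightarrow> j < d \<Longrightarrow> zeta S ^ j \<noteq> 1"
  using setting by (auto simp: setting_def primitive_root_of_unity_def)

lemma zeta_nonzero [simp]: "zeta S \<noteq> 0"
  using order_pos zeta_pow_order by (metis power_0_left zero_neq_one not_gr_zero)

lemma aut_pow_order: "w ^^ d = id"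
proof -
  have "w [^]\<^bsub>lattice_Aut S\<^esub> n = w ^^ n" for n :: nat
  proof (induction n)
    case (Suc n)
    have "w [^]\<^bsub>lattice_Aut S\<^esub> Suc n = (w ^^ n) \<circ> w"
      using Suc by (simp add: nat_pow_def lattice_Aut_def)
    then show ?case by (simp only: funpow_Suc_right)
  qed (simp add: lattice_Aut_def)
  then show ?thesis
    using group.pow_ord_eq_1[OF group_lattice_Aut aut_in_lattice_Aut]
    by (simp add: ord_w_def lattice_Aut_def)
qed

lemma funpow_aut_mod: "(w ^^ (n mod d)) x = (w ^^ n) x"
  by (metis aut_pow_order funpow_mod_eq id_apply)

lemma funpow_aut_comp: "(w ^^ m) ((w ^^ n) x) = (w ^^ (m + n)) x"
  by (simp add: funpow_add)

lemma sum_aut_shift: "(\<Sum>j<d. f ((w ^^ (j + i)) x)) = (\<Sum>j<d. f ((w ^^ j) x))"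
proof -
  \<comment> \<open>\<open>c\<close> represents -i modulo d, so that the inverse of the shift is
    again an addition of natural numbers.\<close>
  define c where "c = d - i mod d"
  have ic: "i + c = d * (i div d + 1)"
  proof -
    have "i mod d + c = d" using mod_less_divisor[OF order_pos, of i] unfolding c_def by linarith
    then have "d * (i div d) + i mod d + c = d * (i div d + 1)"
      by (simp only: add.assoc distrib_left mult_1_right)
    then show ?thesis by (simp only: mult_div_mod_eq)
  qed
  have mod: "((a + i) mod d + c) mod d = a" "((a + c) mod d + i) mod d = a" if "a < d" for a
  proof -
    have "(a + (i + c)) mod d = a" using that by (simp only: ic mod_mult_self2 mod_less)
    then show "((a + i) mod d + c) mod d = a" "((a + c) mod d + i) mod d = a"
      by (simp_all only: mod_add_left_eq add.assoc add.commute[of c])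
  qed
  show ?thesis
    by (rule sum.reindex_bij_witness[of _ "\<lambda>j. (j + c) mod d" "\<lambda>j. (j + i) mod d"])
       (simp_all only: mod lessThan_iff mod_less_divisor[OF order_pos] funpow_aut_mod)
qed

section \<open>The group of coinvariants and vanishing of orbit sums\<close>

lemma comm_group_additive_group: "comm_group (additive_group :: 'l monoid)"
  by (rule comm_groupI) (auto simp: additive_group_def add.assoc add.commute intro: exI[of _ "- x" for x])

lemma inv_additive_group [simp]: "inv\<^bsub>additive_group\<^esub> x = - (x :: 'l)"
proof -
  interpret A: comm_group "additive_group :: 'l monoid" by (rule comm_group_additive_group)
  show ?thesis by (rule A.inv_equality) (auto simp: additive_group_def)
qed

lemma normal_one_minus_w_image: "one_minus_w_image S \<lhd> additive_group"
proof -
  interpret A: comm_group "additive_group :: 'l monoid" by (rule comm_group_additive_group)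
  have "subgroup (one_minus_w_image S) additive_group"
  proof (rule A.subgroupI)
    fix a assume "a \<in> one_minus_w_image S"
    then obtain x where "a = x - w x" by (auto simp: one_minus_w_image_def)
    then have "- a = (- x) - w (- x)" by (simp add: aut_minus)
    then show "inv\<^bsub>additive_group\<^esub> a \<in> one_minus_w_image S"
      unfolding inv_additive_group one_minus_w_image_def by blast
    fix b assume "b \<in> one_minus_w_image S"
    then obtain y where "b = y - w y" by (auto simp: one_minus_w_image_def)
    with \<open>a = x - w x\<close> have "a + b = (x + y) - w (x + y)" by (simp add: aut_add)
    then show "a \<otimes>\<^bsub>additive_group\<^esub> b \<in> one_minus_w_image S"
      unfolding one_minus_w_image_def additive_group_def by auto
  qed (auto simp: additive_group_def one_minus_w_image_def)
  then show ?thesis by (simp add: A.normal_iff_subgroup)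
qed

lemma group_coinvariants: "group (coinvariants S)"
  unfolding coinvariants_def by (rule normal.factorgroup_is_group[OF normal_one_minus_w_image])

lemma coinv_class_hom: "cls \<in> hom additive_group (coinvariants S)"
  using normal.r_coset_hom_Mod[OF normal_one_minus_w_image]
  by (simp add: coinv_class_def[abs_def] coinvariants_def)

lemma coinv_class_closed [simp]: "cls x \<in> carrier (coinvariants S)"
  using coinv_class_hom by (auto simp: hom_def additive_group_def)

lemma coinv_class_add: "cls (x + y) = cls x \<otimes>\<^bsub>coinvariants S\<^esub> cls y"
  using coinv_class_hom by (auto simp: hom_def additive_group_def)

lemma coinv_class_0: "cls 0 = \<one>\<^bsub>coinvariants S\<^esub>"
  using hom_one[OF coinv_class_hom] group_coinvariants comm_group_additive_group
  by (auto simp: comm_group_def additive_group_def)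

lemma coinv_class_eq_iff: "cls x = cls y \<longleftrightarrow> (\<exists>z. x - y = z - w z)"
proof -
  have mem: "u \<in> cls v \<longleftrightarrow> (\<exists>z. u - v = z - w z)" for u v
    by (auto simp: coinv_class_def r_coset_def additive_group_def one_minus_w_image_def algebra_simps)
  have "subgroup (one_minus_w_image S) additive_group"
    using normal_one_minus_w_image by (rule normal_imp_subgroup)
  moreover have "group (additive_group :: 'l monoid)"
    using comm_group_additive_group by (rule comm_group.axioms(2))
  moreover have "u \<in> carrier additive_group" for u :: 'l
    by (simp add: additive_group_def)
  ultimately have "x \<in> cls y \<longleftrightarrow> cls x = cls y"
    unfolding coinv_class_def by (metis group.rcos_self group.repr_independence)
  then show ?thesis using mem by blast
qed

lemma coinv_class_aut [simp]: "cls (w x) = cls x"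
  unfolding coinv_class_eq_iff by (rule exI[of _ "- x"]) (simp add: aut_minus)

lemma coinv_class_funpow_aut [simp]: "cls ((w ^^ n) x) = cls x"
  by (induction n) auto

text \<open>The sum y is fixed by w. As there are finitely many coinvariant classes, two different
  multiples of y have the same class, so a nonzero multiple of y has the form z - wz. Such vectors
  are orthogonal to fixed vectors, because (wz,y) = (wz,wy) = (z,y); hence (y,y) = 0, and positivity
  forces y = 0.\<close>

lemma sum_aut_orbit: "(\<Sum>j<d. (w ^^ j) x) = 0"
proof (rule ccontr)
  define y where "y = (\<Sum>j<d. (w ^^ j) x)"
  assume "(\<Sum>j<d. (w ^^ j) x) \<noteq> 0"
  then have y0: "B y y > 0" using form_pos by (simp add: y_def)
  have "w y = (\<Sum>j<d. w ((w ^^ j) x))"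
    unfolding y_def by (rule aut_sum)
  also have "\<dots> = (\<Sum>j<d. (w ^^ (j + 1)) x)" by simp
  also have "\<dots> = y" unfolding y_def by (rule sum_aut_shift)
  finally have wy: "w y = y" .
  have "finite (range (\<lambda>n::nat. cls (zmul S (int n) y)))"
    by (rule finite_subset[of _ "carrier (coinvariants S)"])
       (use setting in \<open>auto simp: setting_def elliptic_def\<close>)
  then have "\<not> inj (\<lambda>n::nat. cls (zmul S (int n) y))"
    using finite_imageD infinite_UNIV_nat by blast
  then obtain m n :: nat where mn: "m \<noteq> n" "cls (zmul S (int m) y) = cls (zmul S (int n) y)"
    by (auto simp: inj_on_def)
  then obtain z where z: "zmul S (int m) y - zmul S (int n) y = z - w z"
    unfolding coinv_class_eq_iff by blast
  have "(int m - int n) * B y y = B (zmul S (int m) y - zmul S (int n) y) y"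
    by (simp add: form_diff_left form_zmul_left algebra_simps)
  also have "\<dots> = B z y - B (w z) (w y)" unfolding z by (simp add: form_diff_left wy)
  also have "\<dots> = 0" by simp
  finally show False using mn y0 by simp
qed

text \<open>For roots, (a+b,a+b) = 4 + 2(a,b), which is positive unless a + b = 0; integrality does
  the rest.\<close>

lemma form_roots_ge: "a \<in> roots S \<Longrightarrow> b \<in> roots S \<Longrightarrow> b \<noteq> - a \<Longrightarrow> B a b \<ge> -1"
  using form_pos[of "a + b"]
  by (auto simp: roots_def form_add_left form_add_right form_sym[of b a] eq_neg_iff_add_eq_0 add.commute)

lemma root_add_iff: "a \<in> roots S \<Longrightarrow> b \<in> roots S \<Longrightarrow> a + b \<in> roots S \<longleftrightarrow> B a b = -1"
  by (auto simp: roots_def form_add_left form_add_right form_sym[of b a])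

lemma root_aut_iff [simp]: "(w ^^ n) a \<in> roots S \<longleftrightarrow> a \<in> roots S"
  by (simp add: roots_def)

end

section \<open>Commutators in the central extension\<close>

context elliptic_setting
begin

lemma central_extension: "central_extension (mu S) H (coinvariants S) (incl S) (proj S)"
  using setting by (simp add: setting_def)

lemma group_extgrp: "group H"
  and proj_hom: "proj S \<in> hom H (coinvariants S)"
  and proj_surj: "proj S ` carrier H = carrier (coinvariants S)"
  and kernel_proj: "kernel H (coinvariants S) (proj S) = incl S ` carrier (mu S)"
  and incl_hom: "incl S \<in> hom (mu S) H"
  and inj_incl: "inj_on (incl S) (carrier (mu S))"
  using central_extension by (auto simp: central_extension_def)

lemma incl_central:
  "z \<in> carrier (mu S) \<Longrightarrow> x \<in> carrier H \<Longrightarrow> x \<otimes>\<^bsub>H\<^esub> incl S z = incl S z \<otimes>\<^bsub>H\<^esub> x"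
  using central_extension by (auto simp: central_extension_def)

lemma proj_mult:
  "x \<in> carrier H \<Longrightarrow> y \<in> carrier H \<Longrightarrow> proj S (x \<otimes>\<^bsub>H\<^esub> y) = proj S x \<otimes>\<^bsub>coinvariants S\<^esub> proj S y"
  using proj_hom by (auto simp: hom_def)

lemma proj_incl: "z \<in> carrier (mu S) \<Longrightarrow> proj S (incl S z) = \<one>\<^bsub>coinvariants S\<^esub>"
  using kernel_proj by (auto simp: kernel_def)

lemma incl_closed [simp]: "z \<in> carrier (mu S) \<Longrightarrow> incl S z \<in> carrier H"
  using incl_hom by (auto simp: hom_def)

lemma zeta_in_mu [simp]: "zeta S \<in> carrier (mu S)"
  by (auto simp: mu_def intro: exI[of _ 1])

lemma one_in_mu [simp]: "1 \<in> carrier (mu S)"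
  by (auto simp: mu_def intro: exI[of _ 0])

lemma mu_mult [simp]: "z \<in> carrier (mu S) \<Longrightarrow> z' \<in> carrier (mu S) \<Longrightarrow> z * z' \<in> carrier (mu S)"
  by (auto simp: mu_def power_add[symmetric])

lemma incl_mult:
  "z \<in> carrier (mu S) \<Longrightarrow> z' \<in> carrier (mu S) \<Longrightarrow> incl S (z * z') = incl S z \<otimes>\<^bsub>H\<^esub> incl S z'"
  using incl_hom by (auto simp: hom_def mu_def)

lemma incl_1 [simp]: "incl S 1 = \<one>\<^bsub>H\<^esub>"
proof -
  interpret group H by (rule group_extgrp)
  show ?thesis using incl_mult[of 1 1] by simp
qed

text \<open>The pairing is a definite description quantifying over all lifts, so its value is
  accessible only after the commutator has been shown to be independent of the lifts. Two lifts of a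
  class differ by a central element, and central factors occur equally on both sides. The form xy =
  k yx is the one to which a representation can be applied.\<close>

lemma lattice_pairing_commutator:
  assumes x: "x \<in> carrier H" "proj S x = cls a" and y: "y \<in> carrier H" "proj S y = cls b"
  shows "lattice_pairing S a b \<in> carrier (mu S)"
    and "x \<otimes>\<^bsub>H\<^esub> y = incl S (lattice_pairing S a b) \<otimes>\<^bsub>H\<^esub> (y \<otimes>\<^bsub>H\<^esub> x)"
proof -
  interpret group H by (rule group_extgrp)
  interpret Q: group "coinvariants S" by (rule group_coinvariants)
  have comm_iff: "u \<otimes>\<^bsub>H\<^esub> v \<otimes>\<^bsub>H\<^esub> inv\<^bsub>H\<^esub> u \<otimes>\<^bsub>H\<^esub> inv\<^bsub>H\<^esub> v = k \<longleftrightarrow> u \<otimes>\<^bsub>H\<^esub> v = k \<otimes>\<^bsub>H\<^esub> (v \<otimes>\<^bsub>H\<^esub> u)"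
    if "u \<in> carrier H" "v \<in> carrier H" "k \<in> carrier H" for u v k
  proof -
    have "u \<otimes>\<^bsub>H\<^esub> v \<otimes>\<^bsub>H\<^esub> inv\<^bsub>H\<^esub> u \<otimes>\<^bsub>H\<^esub> inv\<^bsub>H\<^esub> v = (u \<otimes>\<^bsub>H\<^esub> v) \<otimes>\<^bsub>H\<^esub> inv\<^bsub>H\<^esub> (v \<otimes>\<^bsub>H\<^esub> u)"
      using that by (simp add: inv_mult_group m_assoc)
    then show ?thesis
      using inv_solve_right'[of k "u \<otimes>\<^bsub>H\<^esub> v" "v \<otimes>\<^bsub>H\<^esub> u"] that by (simp only: m_closed)
  qed
  have same: "\<exists>z\<in>carrier (mu S). u = incl S z \<otimes>\<^bsub>H\<^esub> v"
    if "u \<in> carrier H" "v \<in> carrier H" "proj S u = proj S v" for u v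
  proof -
    have "proj S u = proj S (u \<otimes>\<^bsub>H\<^esub> inv\<^bsub>H\<^esub> v) \<otimes>\<^bsub>coinvariants S\<^esub> proj S v"
      using that by (simp add: proj_mult[symmetric] m_assoc)
    then have "proj S (u \<otimes>\<^bsub>H\<^esub> inv\<^bsub>H\<^esub> v) = \<one>\<^bsub>coinvariants S\<^esub>"
      using that proj_hom by (simp add: hom_in_carrier)
    then have "u \<otimes>\<^bsub>H\<^esub> inv\<^bsub>H\<^esub> v \<in> incl S ` carrier (mu S)"
      using that by (simp add: kernel_proj[symmetric] kernel_def)
    then obtain z where "z \<in> carrier (mu S)" "u \<otimes>\<^bsub>H\<^esub> inv\<^bsub>H\<^esub> v = incl S z" by auto
    then show ?thesis using that by (auto simp: inv_solve_right')
  qed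
  have "proj S (x \<otimes>\<^bsub>H\<^esub> y) = proj S (y \<otimes>\<^bsub>H\<^esub> x)"
    using x y by (simp add: proj_mult coinv_class_add[symmetric] add.commute)
  then obtain k where k: "k \<in> carrier (mu S)" "x \<otimes>\<^bsub>H\<^esub> y = incl S k \<otimes>\<^bsub>H\<^esub> (y \<otimes>\<^bsub>H\<^esub> x)"
    using same x y by (meson m_closed)
  have all: "u \<otimes>\<^bsub>H\<^esub> v = incl S k \<otimes>\<^bsub>H\<^esub> (v \<otimes>\<^bsub>H\<^esub> u)"
    if uv: "u \<in> carrier H" "v \<in> carrier H" "proj S u = cls a" "proj S v = cls b" for u v
  proof -
    obtain p q where p: "p \<in> carrier (mu S)" "u = incl S p \<otimes>\<^bsub>H\<^esub> x"
      and q: "q \<in> carrier (mu S)" "v = incl S q \<otimes>\<^bsub>H\<^esub> y"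
      using same uv x y by metis
    have lcomm: "s \<otimes>\<^bsub>H\<^esub> (incl S z \<otimes>\<^bsub>H\<^esub> t) = incl S z \<otimes>\<^bsub>H\<^esub> (s \<otimes>\<^bsub>H\<^esub> t)"
      if "z \<in> carrier (mu S)" "s \<in> carrier H" "t \<in> carrier H" for s t z
      using that incl_central[of z s] by (simp add: m_assoc[symmetric])
    have "u \<otimes>\<^bsub>H\<^esub> v = incl S p \<otimes>\<^bsub>H\<^esub> (incl S q \<otimes>\<^bsub>H\<^esub> (x \<otimes>\<^bsub>H\<^esub> y))"
      using p q x y by (simp add: m_assoc lcomm[of q x])
    also have "\<dots> = incl S k \<otimes>\<^bsub>H\<^esub> (v \<otimes>\<^bsub>H\<^esub> u)"
      unfolding k(2) using p q x y k(1)
      by (simp add: m_assoc lcomm[of k "incl S p"] lcomm[of k "incl S q"] lcomm[of p "incl S q"]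
            lcomm[of p y] lcomm[of q x])
    finally show ?thesis .
  qed
  have "lattice_pairing S a b = k"
    unfolding lattice_pairing_def commutator_pairing_def
  proof (rule the_equality)
    show "k \<in> carrier (mu S) \<and>
      (\<forall>u\<in>carrier H. \<forall>v\<in>carrier H. proj S u = cls a \<longrightarrow> proj S v = cls b \<longrightarrow>
         u \<otimes>\<^bsub>H\<^esub> v \<otimes>\<^bsub>H\<^esub> inv\<^bsub>H\<^esub> u \<otimes>\<^bsub>H\<^esub> inv\<^bsub>H\<^esub> v = incl S k)"
      using k all by (blast intro: comm_iff[THEN iffD2] incl_closed)
    fix z assume z: "z \<in> carrier (mu S) \<and>
      (\<forall>u\<in>carrier H. \<forall>v\<in>carrier H. proj S u = cls a \<longrightarrow> proj S v = cls b \<longrightarrow>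
         u \<otimes>\<^bsub>H\<^esub> v \<otimes>\<^bsub>H\<^esub> inv\<^bsub>H\<^esub> u \<otimes>\<^bsub>H\<^esub> inv\<^bsub>H\<^esub> v = incl S z)"
    then have "x \<otimes>\<^bsub>H\<^esub> y \<otimes>\<^bsub>H\<^esub> inv\<^bsub>H\<^esub> x \<otimes>\<^bsub>H\<^esub> inv\<^bsub>H\<^esub> y = incl S z" using x y by blast
    moreover have "x \<otimes>\<^bsub>H\<^esub> y \<otimes>\<^bsub>H\<^esub> inv\<^bsub>H\<^esub> x \<otimes>\<^bsub>H\<^esub> inv\<^bsub>H\<^esub> y = incl S k"
      using comm_iff[of x y "incl S k"] x(1) y(1) k(2) incl_closed[OF k(1)] by blast
    ultimately have "incl S z = incl S k" by (rule trans[OF sym])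
    then show "z = k" using z k inj_incl by (auto simp: inj_on_def)
  qed
  then show "lattice_pairing S a b \<in> carrier (mu S)"
    and "x \<otimes>\<^bsub>H\<^esub> y = incl S (lattice_pairing S a b) \<otimes>\<^bsub>H\<^esub> (y \<otimes>\<^bsub>H\<^esub> x)"
    using k by auto
qed

lemma obtain_lift:
  obtains x where "x \<in> carrier H" "proj S x = cls a"
  using proj_surj coinv_class_closed by (metis imageE)

lemma lattice_pairing_eq_1I:
  assumes "x \<in> carrier H" "proj S x = cls a" "y \<in> carrier H" "proj S y = cls b"
    and "x \<otimes>\<^bsub>H\<^esub> y = y \<otimes>\<^bsub>H\<^esub> x"
  shows "lattice_pairing S a b = 1"
proof -
  interpret group H by (rule group_extgrp)
  have "incl S (lattice_pairing S a b) = incl S 1"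
    using lattice_pairing_commutator[OF assms(1-4)] assms by simp
  then show ?thesis
    using lattice_pairing_commutator(1)[OF assms(1-4)] inj_incl by (auto simp: inj_on_def)
qed

text \<open>The inverse of a lift of a is a lift of -a, and it commutes with that lift.\<close>

lemma lattice_pairing_minus_self: "lattice_pairing S (- a) a = 1"
proof (rule obtain_lift[of a])
  interpret group H by (rule group_extgrp)
  interpret Q: group "coinvariants S" by (rule group_coinvariants)
  fix x assume x: "x \<in> carrier H" "proj S x = cls a"
  have "proj S (inv\<^bsub>H\<^esub> x) \<otimes>\<^bsub>coinvariants S\<^esub> cls a = cls (- a) \<otimes>\<^bsub>coinvariants S\<^esub> cls a"
    using x proj_mult[of "inv\<^bsub>H\<^esub> x" x] proj_incl[of 1] by (simp add: coinv_class_add[symmetric] coinv_class_0)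
  then have "proj S (inv\<^bsub>H\<^esub> x) = cls (- a)"
    using x proj_hom by (simp add: hom_in_carrier)
  then show ?thesis using x by (intro lattice_pairing_eq_1I[of "inv\<^bsub>H\<^esub> x" _ x]) auto
qed

lemma lattice_pairing_swap: "lattice_pairing S a b * lattice_pairing S b a = 1"
proof (rule obtain_lift[of a], rule obtain_lift[of b])
  interpret group H by (rule group_extgrp)
  fix x y assume x: "x \<in> carrier H" "proj S x = cls a" and y: "y \<in> carrier H" "proj S y = cls b"
  note xy = lattice_pairing_commutator[OF x y] and yx = lattice_pairing_commutator[OF y x]
  have "x \<otimes>\<^bsub>H\<^esub> y = incl S (lattice_pairing S a b * lattice_pairing S b a) \<otimes>\<^bsub>H\<^esub> (x \<otimes>\<^bsub>H\<^esub> y)"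
    using x y xy yx by (simp add: incl_mult m_assoc)
  then have "incl S (lattice_pairing S a b * lattice_pairing S b a) = incl S 1"
    using x y xy(1) yx(1) by simp
  then show ?thesis using xy(1) yx(1) inj_incl by (auto simp: inj_on_def)
qed

lemma lattice_pairing_funpow_aut [simp]:
  "lattice_pairing S ((w ^^ n) a) b = lattice_pairing S a b"
  "lattice_pairing S a ((w ^^ n) b) = lattice_pairing S a b"
  by (simp_all add: lattice_pairing_def)

end

section \<open>The orbit sum of the special bilinear form\<close>

lemma prod_power_int_exponents:
  fixes x :: "'a::field"
  assumes "x \<noteq> 0"
  shows "(\<Prod>i\<in>I. x powi f i) = x powi (\<Sum>i\<in>I. f i)"
  using assms by (induction I rule: infinite_finite_induct) (auto simp: power_int_add)

locale special_datum = elliptic_setting S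
  for S :: "('l::ab_group_add, 'k::field_char_0, 'h) setup_data" +
  assumes datum: "input_datum S (eps_w S)"
    and pairing: "lattice_pairing S \<alpha> \<beta> = pairing_w S \<alpha> \<beta>"
begin

abbreviation "\<epsilon> \<equiv> eps_w S"

lemma eps_nonzero [simp]: "\<epsilon> a b \<noteq> 0"
  and eps_add_left: "\<epsilon> (a + a') b = \<epsilon> a b * \<epsilon> a' b"
  and eps_add_right: "\<epsilon> a (b + b') = \<epsilon> a b * \<epsilon> a b'"
  and eps_commute: "B a b = -1 \<Longrightarrow> \<epsilon> a b / \<epsilon> b a = - lattice_pairing S b a"
  and eps_aut [simp]: "\<epsilon> (w a) (w b) = \<epsilon> a b"
  using datum by (simp_all add: input_datum_def)

lemma eps_funpow_aut [simp]: "\<epsilon> ((w ^^ n) a) ((w ^^ n) b) = \<epsilon> a b"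
  by (induction n) auto

lemma eps_0: "\<epsilon> 0 b = 1" "\<epsilon> a 0 = 1"
  using eps_add_left[of 0 0 b] eps_add_right[of a 0 0] by simp_all

lemma eps_minus_left: "\<epsilon> (- a) b = inverse (\<epsilon> a b)"
  using eps_add_left[of a "- a" b] eps_0 by (simp add: field_simps)

lemma eps_minus_right: "\<epsilon> a (- b) = inverse (\<epsilon> a b)"
  using eps_add_right[of a b "- b"] eps_0 by (simp add: field_simps)

text \<open>The numbers y_j = \<zeta>^(-j). They enter \<open>eps_w\<close> through its factors 1 -
  y_j, and their inverses are the possible zeros and poles of F.\<close>

definition node :: "nat \<Rightarrow> 'k" where "node j = zeta S powi (- int j)"

lemma node_nonzero [simp]: "node j \<noteq> 0"
  by (simp add: node_def)

lemma inj_on_node: "inj_on node {..<d}"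
proof -
  have "i = j" if "i \<le> j" "j < d" "node i = node j" for i j
  proof (rule ccontr)
    assume "i \<noteq> j"
    have "zeta S ^ (j - i) = 1"
      using that by (simp add: node_def power_int_minus power_diff)
    with \<open>i \<noteq> j\<close> show False using zeta_primitive[of "j - i"] that by simp
  qed
  then show ?thesis by (auto simp: inj_on_def) (metis nat_le_linear)
qed

lemma node_ratio: "i < d \<Longrightarrow> l < d \<Longrightarrow> node ((l + i) mod d) / node i = node l"
proof -
  assume "i < d" "l < d"
  then have "(l + i) mod d = (if l + i < d then l + i else l + i - d)"
    by (simp add: mod_if)
  then show ?thesis
    using zeta_pow_order
    by (auto simp: node_def power_int_minus power_add power_diff divide_simps)
qed

text \<open>Substitute j = l + i modulo d: the exponent (w^(l+i) a, b) becomes m_j, and 1 -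
  \<zeta>^(-l) becomes 1 - y_j/y_i. The value l = 0, absent from the definition, corresponds to the
  omitted index j = i.\<close>

lemma eps_funpow_aut_left:
  assumes i: "i < d"
  shows "\<epsilon> ((w ^^ i) a) b = (\<Prod>j\<in>{..<d} - {i}. (1 - node j / node i) powi B ((w ^^ j) a) b)"
proof -
  have shift: "(l + i) mod d = (if l + i < d then l + i else l + i - d)" if "l < d" for l
    using that i by (simp add: mod_if)
  have shift_back: "(j + (d - i)) mod d = (if j < i then j + (d - i) else j - i)" if "j < d" for j
    using that i by (auto simp: mod_if)
  show ?thesis unfolding eps_w_def
  proof (rule prod.reindex_bij_witness[of _ "\<lambda>j. (j + (d - i)) mod d" "\<lambda>l. (l + i) mod d"])
    fix l assume l: "l \<in> {1..d - 1}"
    then have ld: "l < d" using order_pos by auto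
    show "((l + i) mod d + (d - i)) mod d = l"
      using l ld i shift[OF ld] shift_back[of "(l + i) mod d"] order_pos by (simp split: if_splits; arith)
    show "(l + i) mod d \<in> {..<d} - {i}"
      using l ld i shift[OF ld] order_pos by (simp split: if_splits; arith)
    show "(1 - node ((l + i) mod d) / node i) powi B ((w ^^ ((l + i) mod d)) a) b
        = (1 - zeta S powi - int l) powi B ((w ^^ l) ((w ^^ i) a)) b"
      unfolding funpow_aut_mod node_ratio[OF i ld] by (simp only: funpow_aut_comp node_def)
  next
    fix j assume j: "j \<in> {..<d} - {i}"
    then have jd: "j < d" by auto
    show "((j + (d - i)) mod d + i) mod d = j"
      using j i shift_back[OF jd] shift[of "(j + (d - i)) mod d"] order_pos by (simp split: if_splits; arith)
    show "(j + (d - i)) mod d \<in> {1..d - 1}"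
      using j i shift_back[OF jd] order_pos by (simp split: if_splits; arith)
  qed
qed

lemma sum_form_orbit: "(\<Sum>j<d. B ((w ^^ j) a) b) = 0"
  by (simp add: form_sum_left[symmetric] sum_aut_orbit)

text \<open>This is the value F(\<infinity>). The signs disappear because the exponents add up to
  zero. The power of \<zeta> that remains is the inverse of the pairing of a with b, and inverting a
  commutator exchanges its arguments.\<close>

lemma prod_nodes: "(\<Prod>j<d. (- node j) powi B ((w ^^ j) a) b) = lattice_pairing S b a"
proof -
  have "(\<Prod>j<d. (- node j) powi B ((w ^^ j) a) b)
      = (\<Prod>j<d. (- 1) powi B ((w ^^ j) a) b * zeta S powi (- int j * B ((w ^^ j) a) b))"
    by (intro prod.cong refl)
       (metis mult_minus1 node_def power_int_mult power_int_mult_distrib)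
  also have "\<dots> = (- 1) powi (\<Sum>j<d. B ((w ^^ j) a) b) * zeta S powi (\<Sum>j<d. - int j * B ((w ^^ j) a) b)"
    by (simp add: prod.distrib prod_power_int_exponents del: mult_minus_left)
  also have "(\<Sum>j<d. - int j * B ((w ^^ j) a) b) = - (\<Sum>j=1..d-1. int j * B ((w ^^ j) a) b)"
  proof -
    have "{..<d} = insert 0 {1..d-1}" using order_pos by auto
    then show ?thesis by (simp add: sum_negf)
  qed
  also have "(- 1) powi (\<Sum>j<d. B ((w ^^ j) a) b) * zeta S powi \<dots> = inverse (lattice_pairing S a b)"
    unfolding sum_form_orbit pairing pairing_w_def by (simp add: power_int_minus)
  also have "\<dots> = lattice_pairing S b a"
    using lattice_pairing_swap[of a b] by (rule inverse_unique)
  finally show ?thesis .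
qed

lemma sum_eps_orbit:
  assumes a: "a \<in> roots S" and b: "b \<in> roots S"
  shows "(\<Sum>j<d. if B ((w ^^ j) a) b = -1 then \<epsilon> ((w ^^ j) a) b else 0) = 1 - lattice_pairing S b a"
proof (cases "\<exists>i. b = - (w ^^ i) a")
  case False
  \<comment> \<open>Two roots pair to less than -1 only if they are opposite, so outside the orbit
    of -a all poles are simple.\<close>
  then have m: "B ((w ^^ j) a) b \<ge> -1" for j
    using a b by (intro form_roots_ge) auto
  have "(\<Sum>j<d. if B ((w ^^ j) a) b = -1 then \<epsilon> ((w ^^ j) a) b else 0)
      = (\<Sum>j | j \<in> {..<d} \<and> B ((w ^^ j) a) b = -1. \<epsilon> ((w ^^ j) a) b)"
    by (rule sum.inter_filter[symmetric]) simp
  also have "\<dots> = (\<Sum>i | i \<in> {..<d} \<and> B ((w ^^ i) a) b = -1.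
      \<Prod>j\<in>{..<d} - {i}. (1 - node j / node i) powi B ((w ^^ j) a) b)"
    by (intro sum.cong) (auto simp: eps_funpow_aut_left)
  also have "\<dots> = 1 - (\<Prod>i<d. (- node i) powi B ((w ^^ i) a) b)"
    by (rule sum_residues_simple_poles) (auto simp: inj_on_node m sum_form_orbit)
  finally show ?thesis by (simp add: prod_nodes)
next
  case True
  then obtain i where i: "b = - (w ^^ i) a" by blast
  define F where "F x = (if B x b = -1 then \<epsilon> x b else 0)" for x
  text \<open>The terms of \<open>w\<^sup>j a\<close> and \<open>w\<^sup>2\<^sup>i\<^sup>-\<^sup>j a\<close> cancel; to stay in the natural numbers, \<open>-j\<close> is
    represented by \<open>(d - 1) * j\<close>.\<close>
  have cancel: "F ((w ^^ ((d - 1) * j + 2 * i)) a) = - F ((w ^^ j) a)" for j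
  proof -
    define x where "x = (w ^^ j) a"
    define y where "y = (w ^^ ((d - 1) * j + 2 * i)) a"
    have "j + ((d - 1) * j + 2 * i) = i + i + d * j" using order_pos by (cases d) auto
    \<comment> \<open>Here y stands for w^(2i-j) a. Applying w^j to the pair (y, w^i a) and then
      removing w^i yields (w^i a, x): invariance under w therefore interchanges the roles of the two
      arguments.\<close>
    then have wy: "(w ^^ j) y = (w ^^ i) ((w ^^ i) a)"
      unfolding y_def funpow_aut_comp by (metis funpow_aut_mod mod_mult_self2)
    have wx: "(w ^^ j) ((w ^^ i) a) = (w ^^ i) x"
      unfolding x_def funpow_aut_comp by (simp only: add.commute)
    have Bxy: "B y b = B x b"
    proof -
      have "B y ((w ^^ i) a) = B ((w ^^ j) y) ((w ^^ j) ((w ^^ i) a))"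
        by (simp only: form_funpow_aut)
      also have "\<dots> = B ((w ^^ i) ((w ^^ i) a)) ((w ^^ i) x)" by (simp only: wy wx)
      also have "\<dots> = B x ((w ^^ i) a)" unfolding form_funpow_aut by (rule form_sym)
      finally show ?thesis by (simp add: i)
    qed
    have "\<epsilon> y ((w ^^ i) a) = \<epsilon> ((w ^^ j) y) ((w ^^ j) ((w ^^ i) a))"
      by (simp only: eps_funpow_aut)
    also have "\<dots> = \<epsilon> ((w ^^ i) ((w ^^ i) a)) ((w ^^ i) x)" by (simp only: wy wx)
    also have "\<dots> = \<epsilon> ((w ^^ i) a) x" by (simp only: eps_funpow_aut)
    finally have "\<epsilon> y b = \<epsilon> b x" by (simp add: i eps_minus_left eps_minus_right)
    \<comment> \<open>The classes of b = -w^i a and x = w^j a are opposite, so their pairing is 1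
      and the commutation axiom leaves only the sign.\<close>
    moreover have "\<epsilon> x b = - \<epsilon> b x" if "B x b = -1"
    proof -
      have "lattice_pairing S b x = 1"
        using lattice_pairing_minus_self[of "(w ^^ i) a"] by (simp add: i x_def)
      then show ?thesis using eps_commute[OF that] by (simp add: field_simps)
    qed
    ultimately show ?thesis
      unfolding F_def x_def[symmetric] y_def[symmetric] using Bxy by simp
  qed
  have "(\<Sum>j<d. F ((w ^^ j) a)) = (\<Sum>j<d. F ((w ^^ ((d - 1) * j + 2 * i)) a))"
  proof -
    \<comment> \<open>The extra 1 in the shift compensates for the \<open>Suc\<close> in the
      reversal of the range, which sends j to d - Suc j.\<close>
    have "(\<Sum>j<d. F ((w ^^ j) a)) = (\<Sum>j<d. F ((w ^^ (j + 2 * i + 1)) a))"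
      using sum_aut_shift[of F "2 * i + 1" a] by simp
    also have "\<dots> = (\<Sum>j<d. F ((w ^^ (d - Suc j + 2 * i + 1)) a))"
      by (rule sum.nat_diff_reindex[symmetric])
    also have "\<dots> = (\<Sum>j<d. F ((w ^^ ((d - 1) * j + 2 * i)) a))"
    proof (intro sum.cong refl arg_cong[where f = F])
      fix j assume "j \<in> {..<d}"
      then have "d - Suc j + Suc j = d" by simp
      moreover have "(d - 1) * j + j = d * j" using order_pos by (cases d) auto
      ultimately have "(d - 1) * j + 2 * i + d = (d - Suc j + 2 * i + 1) + d * j"
        by linarith
      then have "((d - 1) * j + 2 * i) mod d = (d - Suc j + 2 * i + 1) mod d"
        by (metis mod_add_self2 mod_mult_self2)
      then show "(w ^^ (d - Suc j + 2 * i + 1)) a = (w ^^ ((d - 1) * j + 2 * i)) a"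
        by (metis funpow_aut_mod)
    qed
    finally show ?thesis .
  qed
  then have "(\<Sum>j<d. F ((w ^^ j) a)) = - (\<Sum>j<d. F ((w ^^ j) a))"
    unfolding cancel sum_negf .
  then have "(\<Sum>j<d. F ((w ^^ j) a)) = 0" by (simp add: eq_neg_iff_add_eq_0)
  moreover have "lattice_pairing S b a = 1"
    using lattice_pairing_minus_self[of "(w ^^ i) a"] by (simp add: i)
  ultimately show ?thesis by (simp add: F_def)
qed

end

section \<open>Linear extension from symbols\<close>

text \<open>The scalar multiplication is a parameter because the same extension is needed with
  values in formal combinations, in the field k, and in V with k acting through the embedding into
  K.\<close>

definition lin_ext :: "('c \<Rightarrow> 'v \<Rightarrow> 'v) \<Rightarrow> ('a \<Rightarrow> 'v) \<Rightarrow> ('a \<Rightarrow>\<^sub>0 'c::zero) \<Rightarrow> 'v::comm_monoid_add" where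
  "lin_ext scl \<phi> f = (\<Sum>a\<in>Poly_Mapping.keys f. scl (Poly_Mapping.lookup f a) (\<phi> a))"

lemma lin_ext_cong:
  "(\<And>a. a \<in> Poly_Mapping.keys f \<Longrightarrow> \<phi> a = \<psi> a) \<Longrightarrow> lin_ext scl \<phi> f = lin_ext scl \<psi> f"
  by (simp add: lin_ext_def)

lemma lookup_fscale [simp]: "Poly_Mapping.lookup (fscale c f) a = c * Poly_Mapping.lookup f a"
  by (simp add: fscale_def Poly_Mapping.map.rep_eq when_def)

lemma keys_fscale: "Poly_Mapping.keys (fscale c f) \<subseteq> Poly_Mapping.keys f"
  by (auto simp: in_keys_iff)

lemma module_fscale: "Modules.module fscale"
  by unfold_locales (auto intro!: poly_mapping_eqI simp: lookup_add algebra_simps)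

lemma fscale_single: "fscale c (Poly_Mapping.single a 1) = Poly_Mapping.single a c"
  by (intro poly_mapping_eqI) (simp add: lookup_single when_def)

context Modules.module
begin

lemma lin_ext_superset:
  assumes "finite K" "Poly_Mapping.keys f \<subseteq> K"
  shows "lin_ext scale \<phi> f = (\<Sum>a\<in>K. scale (Poly_Mapping.lookup f a) (\<phi> a))"
  unfolding lin_ext_def
  by (rule sum.mono_neutral_left) (use assms in \<open>auto simp: in_keys_iff\<close>)

lemma lin_ext_0 [simp]: "lin_ext scale \<phi> 0 = 0"
  by (simp add: lin_ext_def)

lemma lin_ext_add: "lin_ext scale \<phi> (f + g) = lin_ext scale \<phi> f + lin_ext scale \<phi> g"
proof -
  let ?K = "Poly_Mapping.keys f \<union> Poly_Mapping.keys g"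
  have "Poly_Mapping.keys (f + g) \<subseteq> ?K" by (rule keys_add)
  then show ?thesis
    by (simp add: lin_ext_superset[of ?K] lookup_add scale_left_distrib sum.distrib)
qed

lemma lin_ext_single: "lin_ext scale \<phi> (Poly_Mapping.single a c) = scale c (\<phi> a)"
  by (simp add: lin_ext_def)

lemma lin_ext_sum: "lin_ext scale \<phi> (\<Sum>i\<in>I. f i) = (\<Sum>i\<in>I. lin_ext scale \<phi> (f i))"
  by (induction I rule: infinite_finite_induct) (auto simp: lin_ext_add)

lemma lin_ext_add_fun:
  "lin_ext scale (\<lambda>a. \<phi> a + \<psi> a) f = lin_ext scale \<phi> f + lin_ext scale \<psi> f"
  by (simp add: lin_ext_def scale_right_distrib sum.distrib)

lemma lin_ext_sum_fun:
  "lin_ext scale (\<lambda>a. \<Sum>i\<in>I. \<phi> i a) f = (\<Sum>i\<in>I. lin_ext scale (\<phi> i) f)"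
  unfolding lin_ext_def scale_sum_right by (rule sum.swap)

lemma lin_ext_diff_fun:
  "lin_ext scale (\<lambda>a. \<phi> a - \<psi> a) f = lin_ext scale \<phi> f - lin_ext scale \<psi> f"
  by (simp add: lin_ext_def scale_right_diff_distrib sum_subtractf)

lemma scale_lin_ext: "scale c (lin_ext scale \<phi> f) = lin_ext scale (\<lambda>a. scale c (\<phi> a)) f"
  by (simp add: lin_ext_def scale_sum_right mult.commute)

text \<open>A bilinear extension can be evaluated in either order; this brings the argument that is
  being varied to the outside.\<close>

lemma lin_ext_swap:
  "lin_ext scale (\<lambda>a. lin_ext scale (\<phi> a) g) f = lin_ext scale (\<lambda>b. lin_ext scale (\<lambda>a. \<phi> a b) f) g"
  unfolding lin_ext_def scale_sum_right scale_scale
  by (subst sum.swap) (simp add: mult.commute)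

lemma lin_ext_in_subspace:
  assumes "subspace N" "\<And>a. a \<in> Poly_Mapping.keys f \<Longrightarrow> \<phi> a \<in> N"
  shows "lin_ext scale \<phi> f \<in> N"
  unfolding lin_ext_def using assms by (intro subspace_sum subspace_scale)

end

lemma module_hom_apply_lin_ext:
  assumes "Modules.module_hom scl scl' T"
  shows "T (lin_ext scl \<phi> f) = lin_ext scl' (\<lambda>a. T (\<phi> a)) f"
  unfolding lin_ext_def by (simp add: module_hom.sum[OF assms] module_hom.scale[OF assms])

context
  fixes scl :: "'k::field \<Rightarrow> 'v::ab_group_add \<Rightarrow> 'v"
  assumes m: "Modules.module scl"
begin

lemma lin_ext_scale: "lin_ext scl \<phi> (fscale c f) = scl c (lin_ext scl \<phi> f)"
proof -
  interpret Modules.module scl by (rule m)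
  show ?thesis
    unfolding lin_ext_superset[OF finite_keys keys_fscale]
    by (simp add: lin_ext_def scale_sum_right)
qed

lemma module_hom_lin_ext: "Modules.module_hom fscale scl (lin_ext scl \<phi>)"
  by (intro module_hom.intro m module_fscale module_hom_axioms.intro lin_ext_scale
        module.lin_ext_add)

lemma lin_ext_diff: "lin_ext scl \<phi> (f - g) = lin_ext scl \<phi> f - lin_ext scl \<phi> g"
  by (rule module_hom.diff[OF module_hom_lin_ext])

lemma lin_ext_push_forward: "lin_ext scl \<phi> (push_forward u f) = lin_ext scl (\<lambda>a. \<phi> (u a)) f"
proof -
  interpret Modules.module scl by (rule m)
  have "push_forward u f = lin_ext fscale (\<lambda>a. Poly_Mapping.single (u a) 1) f"
    by (simp add: push_forward_def lin_ext_def)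
  then show ?thesis
    by (simp add: module_hom_apply_lin_ext[OF module_hom_lin_ext] lin_ext_single)
qed

end

section \<open>The quotient by the relations and its Lie bracket\<close>

context elliptic_setting
begin

abbreviation "X \<equiv> tilde_roots S"
abbreviation "R \<equiv> relations S"
abbreviation "W \<equiv> tilde_aut S"

text \<open>Multiplication by \<zeta> in the extension of the lattice, written so that the lattice
  component visibly stays the same.\<close>

definition zeta_mult :: "'l \<times> 'h \<Rightarrow> 'l \<times> 'h" where
  "zeta_mult a = (fst a, incl S (zeta S) \<otimes>\<^bsub>H\<^esub> snd a)"

lemma tilde_mult: "a \<otimes>\<^bsub>tilde_lattice S\<^esub> b = (fst a + fst b, snd a \<otimes>\<^bsub>H\<^esub> snd b)"
  by (cases a; cases b) (simp add: tilde_lattice_def DirProd_def additive_group_def)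

lemma tilde_incl_mult: "tilde_incl S (zeta S) \<otimes>\<^bsub>tilde_lattice S\<^esub> a = zeta_mult a"
  by (simp add: tilde_mult tilde_incl_def zeta_mult_def)

lemma tilde_roots_iff:
  "a \<in> X \<longleftrightarrow> snd a \<in> carrier H \<and> cls (fst a) = proj S (snd a) \<and> fst a \<in> roots S"
  by (cases a) (auto simp: tilde_roots_def tilde_lattice_def)

lemma zeta_mult_tilde_root: "a \<in> X \<Longrightarrow> zeta_mult a \<in> X"
proof -
  interpret H: group H by (rule group_extgrp)
  interpret Q: group "coinvariants S" by (rule group_coinvariants)
  show "a \<in> X \<Longrightarrow> zeta_mult a \<in> X"
    using coinv_class_closed[of "fst a"]
    by (auto simp: tilde_roots_iff zeta_mult_def proj_mult proj_incl)
qed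

lemma tilde_mult_root:
  "a \<in> X \<Longrightarrow> b \<in> X \<Longrightarrow> fst a + fst b \<in> roots S \<Longrightarrow> a \<otimes>\<^bsub>tilde_lattice S\<^esub> b \<in> X"
  using group_extgrp
  by (auto simp: tilde_roots_iff tilde_mult proj_mult coinv_class_add group_def monoid.m_closed)

lemma zeta_mult_left: "a \<in> X \<Longrightarrow> b \<in> X \<Longrightarrow>
    zeta_mult a \<otimes>\<^bsub>tilde_lattice S\<^esub> b = zeta_mult (a \<otimes>\<^bsub>tilde_lattice S\<^esub> b)"
  using group_extgrp
  by (auto simp: tilde_roots_iff tilde_mult zeta_mult_def group_def monoid.m_assoc)

lemma zeta_mult_right: "a \<in> X \<Longrightarrow> b \<in> X \<Longrightarrow>
    a \<otimes>\<^bsub>tilde_lattice S\<^esub> zeta_mult b = zeta_mult (a \<otimes>\<^bsub>tilde_lattice S\<^esub> b)"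
proof -
  interpret H: group H by (rule group_extgrp)
  assume "a \<in> X" "b \<in> X"
  then show ?thesis
    using incl_central[OF zeta_in_mu, of "snd a"]
    by (simp add: tilde_roots_iff tilde_mult zeta_mult_def H.m_assoc[symmetric])
qed

lemma funpow_tilde_aut: "(W ^^ n) a = ((w ^^ n) (fst a), snd a)"
  by (induction n) (auto simp: tilde_aut_def)

lemma tilde_aut_root_iff [simp]: "(W ^^ n) a \<in> X \<longleftrightarrow> a \<in> X"
  by (simp add: tilde_roots_iff funpow_tilde_aut)

lemma tilde_aut_root [simp]: "W a \<in> X \<longleftrightarrow> a \<in> X"
  using tilde_aut_root_iff[of 1 a] by simp

lemma tilde_scalar_zeta_mult:
  assumes "snd c \<in> carrier H" "proj S (snd c) = \<one>\<^bsub>coinvariants S\<^esub>"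
  shows "tilde_scalar S (zeta_mult c) = zeta S * tilde_scalar S c"
proof -
  have "snd c \<in> incl S ` carrier (mu S)"
    using assms by (simp add: kernel_proj[symmetric] kernel_def)
  then obtain z where z: "z \<in> carrier (mu S)" "snd c = incl S z" by auto
  then show ?thesis
    by (simp add: tilde_scalar_def zeta_mult_def incl_mult[symmetric] the_inv_into_f_f inj_incl)
qed

section \<open>Relations, the quotient by them, and invariant classes\<close>

lemma subspace_relations: "Modules.module.subspace fscale R"
  unfolding relations_def by (rule module.subspace_span[OF module_fscale])

lemmas relations_0 [simp] = module.subspace_0[OF module_fscale subspace_relations]
lemmas relations_add = module.subspace_add[OF module_fscale subspace_relations]
lemmas relations_diff = module.subspace_diff[OF module_fscale subspace_relations]
lemmas relations_scale = module.subspace_scale[OF module_fscale subspace_relations]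
lemmas relations_sum = module.subspace_sum[OF module_fscale subspace_relations]

lemma relation_zeta_mult:
  "a \<in> X \<Longrightarrow> Poly_Mapping.single (zeta_mult a) 1 - fscale (zeta S) (Poly_Mapping.single a 1) \<in> R"
  unfolding relations_def tilde_incl_mult
  by (rule module.span_base[OF module_fscale]) blast

text \<open>The universal property of the quotient, checked on the generating relations. It is
  stated modulo a subspace \<open>N\<close> because the bracket of two symbols respects the
  relations only modulo \<open>R\<close>; for scalars and for V the zero subspace is used.\<close>

lemma lin_ext_relations:
  assumes m: "Modules.module scl" and N: "Modules.module.subspace scl N"
    and \<phi>: "\<And>a. a \<in> X \<Longrightarrow> \<phi> (zeta_mult a) - scl (zeta S) (\<phi> a) \<in> N"
    and f: "f \<in> R"
  shows "lin_ext scl \<phi> f \<in> N"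
proof -
  interpret Modules.module scl by (rule m)
  show ?thesis
  proof (rule module.span_induct[OF module_fscale f[unfolded relations_def]])
    show "Modules.module.subspace fscale {f. lin_ext scl \<phi> f \<in> N}"
      unfolding module.subspace_def[OF module_fscale]
      using N by (auto simp: lin_ext_add lin_ext_scale[OF m] subspace_0 subspace_add subspace_scale)
    fix g assume "g \<in> {Poly_Mapping.single (tilde_incl S (zeta S) \<otimes>\<^bsub>tilde_lattice S\<^esub> a) 1
          - fscale (zeta S) (Poly_Mapping.single a 1) | a. a \<in> X}"
    then obtain a where a: "a \<in> X"
      "g = Poly_Mapping.single (zeta_mult a) 1 - fscale (zeta S) (Poly_Mapping.single a 1)"
      unfolding tilde_incl_mult by blast
    then show "lin_ext scl \<phi> g \<in> N"
      using \<phi>[OF a(1)] by (simp add: lin_ext_diff[OF m] lin_ext_scale[OF m] lin_ext_single)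
  qed
qed

lemma lin_ext_relations_eq_0:
  assumes m: "Modules.module scl"
    and \<phi>: "\<And>a. a \<in> X \<Longrightarrow> \<phi> (zeta_mult a) = scl (zeta S) (\<phi> a)"
    and f: "f \<in> R"
  shows "lin_ext scl \<phi> f = 0"
  using lin_ext_relations[OF m module.subspace_single_0[OF m] _ f, of \<phi>] \<phi> by auto

lemma lin_ext_cong_relations:
  assumes m: "Modules.module scl"
    and \<phi>: "\<And>a. a \<in> X \<Longrightarrow> \<phi> (zeta_mult a) = scl (zeta S) (\<phi> a)"
    and f: "f - g \<in> R"
  shows "lin_ext scl \<phi> f = lin_ext scl \<phi> g"
  using lin_ext_relations_eq_0[of scl \<phi>, OF m \<phi> f] by (simp add: lin_ext_diff[OF m])

lemma subspace_free_space: "Modules.module.subspace fscale (free_space S)"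
  unfolding module.subspace_def[OF module_fscale] free_space_def
  by (simp add: subset_trans[OF keys_add] subset_trans[OF keys_fscale])

lemma single_free_space: "a \<in> X \<Longrightarrow> Poly_Mapping.single a c \<in> free_space S"
  by (simp add: free_space_def)

text \<open>Guarantees that a representative of a class in \<open>l_space\<close> is supported on
  lifts of roots, whichever one \<open>lrep\<close> picks.\<close>

lemma relations_subset_free_space: "R \<subseteq> free_space S"
  unfolding relations_def
  by (rule module.span_minimal[OF module_fscale _ subspace_free_space])
     (auto simp: tilde_incl_mult intro!: module.subspace_diff[OF module_fscale subspace_free_space]
        module.subspace_scale[OF module_fscale subspace_free_space] single_free_space zeta_mult_tilde_root)

lemma free_space_keys: "f \<in> free_space S \<Longrightarrow> a \<in> Poly_Mapping.keys f \<Longrightarrow> a \<in> X"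
  by (auto simp: free_space_def)

lemma push_forward_eq: "push_forward u f = lin_ext fscale (\<lambda>a. Poly_Mapping.single (u a) 1) f"
  by (simp add: push_forward_def lin_ext_def)

lemma push_forward_diff: "push_forward u (f - g) = push_forward u f - push_forward u g"
  unfolding push_forward_eq by (rule lin_ext_diff[OF module_fscale])

lemma push_forward_free_space: "f \<in> free_space S \<Longrightarrow> push_forward (W ^^ n) f \<in> free_space S"
  unfolding push_forward_eq
  by (rule module.lin_ext_in_subspace[OF module_fscale subspace_free_space])
     (auto intro!: single_free_space dest: free_space_keys)

lemma push_forward_comp: "push_forward u (push_forward v f) = push_forward (u \<circ> v) f"
  unfolding push_forward_eq[of u] lin_ext_push_forward[OF module_fscale]
  by (simp add: push_forward_eq)

lemma push_forward_relations: "f \<in> R \<Longrightarrow> push_forward W f \<in> R"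
  unfolding push_forward_eq
proof (rule lin_ext_relations[OF module_fscale subspace_relations])
  fix a assume "a \<in> X"
  moreover have "W (zeta_mult a) = zeta_mult (W a)" by (simp add: tilde_aut_def zeta_mult_def)
  ultimately show "Poly_Mapping.single (W (zeta_mult a)) 1 - fscale (zeta S) (Poly_Mapping.single (W a) 1) \<in> R"
    using relation_zeta_mult[of "W a"] by simp
qed

text \<open>Telescoping: the difference for n + 1 is the image of the difference for n plus the
  difference for 1, and \<open>R\<close> is stable under w.\<close>

lemma push_forward_funpow_relations:
  assumes "push_forward W f - f \<in> R"
  shows "push_forward (W ^^ n) f - f \<in> R"
proof (induction n)
  case 0
  have "push_forward (W ^^ 0) f = f"
    by (intro poly_mapping_eqI) (auto simp: push_forward_def fscale_single lookup_sum lookup_single when_def in_keys_iff)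
  then show ?case by (simp only: diff_self relations_0)
next
  case (Suc n)
  have "push_forward (W ^^ Suc n) f - f = push_forward W (push_forward (W ^^ n) f - f) + (push_forward W f - f)"
    by (simp add: push_forward_diff push_forward_comp)
  then show ?case using Suc assms by (simp only: relations_add push_forward_relations)
qed

lemma lclass_eq_iff: "lclass S f = lclass S g \<longleftrightarrow> f - g \<in> R"
proof
  assume "lclass S f = lclass S g"
  moreover have "f \<in> lclass S f" by (simp add: lclass_def)
  ultimately show "f - g \<in> R" by (simp add: lclass_def)
next
  assume fg: "f - g \<in> R"
  have "h - f \<in> R \<longleftrightarrow> h - g \<in> R" for h
    using relations_add[OF _ fg, of "h - f"] relations_diff[OF _ fg, of "h - g"]
    by (auto simp: algebra_simps)
  then show "lclass S f = lclass S g" by (simp add: lclass_def)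
qed

lemma lrep_lclass: "lrep (lclass S f) - f \<in> R"
proof -
  have "f \<in> lclass S f" by (simp add: lclass_def)
  then have "lrep (lclass S f) \<in> lclass S f" unfolding lrep_def by (rule someI)
  then show ?thesis by (simp add: lclass_def)
qed

lemma lrep_free_space:
  assumes "A \<in> l_space S"
  shows "lrep A \<in> free_space S" "lclass S (lrep A) = A"
proof -
  obtain f where f: "f \<in> free_space S" "A = lclass S f" using assms by (auto simp: l_space_def)
  have "f + (lrep A - f) \<in> free_space S"
    using lrep_lclass[of f] relations_subset_free_space f
    by (intro module.subspace_add[OF module_fscale subspace_free_space]) auto
  then show "lrep A \<in> free_space S" by simp
  show "lclass S (lrep A) = A" using lrep_lclass[of f] by (simp add: f lclass_eq_iff)
qed

text \<open>An invariant coset has representatives that are invariant only modulo \<open>R\<close>.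
  This weaker condition describes membership in the fixed algebra from here on.\<close>

lemma w_lift_lclass:
  "w_lift S (\<lambda>_. 0, lclass S f) = (\<lambda>_. 0, lclass S f) \<longleftrightarrow> push_forward W f - f \<in> R"
proof -
  let ?g = "lrep (lclass S f)"
  have "push_forward W ?g - push_forward W f \<in> R"
    using push_forward_relations[OF lrep_lclass[of f]] by (simp add: push_forward_diff)
  then have "lclass S (push_forward W ?g) = lclass S (push_forward W f)"
    by (simp only: lclass_eq_iff)
  then show ?thesis by (simp add: w_lift_def o_def) (rule lclass_eq_iff)
qed

lemma zero_t_space [simp]: "(\<lambda>_. 0) \<in> t_space"
  by (simp add: t_space_def)

lemma g_carrierI:
  "f \<in> free_space S \<Longrightarrow> push_forward W f - f \<in> R \<Longrightarrow> (\<lambda>_. 0, lclass S f) \<in> carrier (g_alg S \<epsilon>)"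
  by (simp add: g_alg_def h_alg_def w_lift_lclass l_space_def)

lemma t_space_sum: "\<tau> \<in> t_space \<Longrightarrow> \<tau> (\<Sum>i\<in>I. h i) = (\<Sum>i\<in>I. \<tau> (h i))"
proof -
  assume \<tau>: "\<tau> \<in> t_space"
  then have "\<tau> 0 = 0" by (auto simp: t_space_def) (metis add_cancel_right_right)
  with \<tau> show ?thesis
    by (induction I rule: infinite_finite_induct) (auto simp: t_space_def)
qed

text \<open>Invariance makes \<tau> constant on orbits, so d times \<tau>(x) is the value of \<tau>
  at an orbit sum, which is zero.\<close>

lemma invariant_t_space:
  fixes \<tau> :: "'l \<Rightarrow> 'k"
  assumes "\<tau> \<in> t_space" and inv: "\<tau> \<circ> Hilbert_Choice.inv w = \<tau>"
  shows "\<tau> = (\<lambda>_. 0)"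
proof
  fix x
  have "\<tau> (w y) = \<tau> y" for y
    using fun_cong[OF inv, of "w y"] bij_aut by (simp add: bij_is_inj inv_f_f)
  then have "\<tau> ((w ^^ j) x) = \<tau> x" for j by (induction j) auto
  then have "of_nat d * \<tau> x = \<tau> (\<Sum>j<d. (w ^^ j) x)"
    using assms by (simp add: t_space_sum)
  also have "\<dots> = 0"
    using assms t_space_sum[of \<tau> "\<lambda>_. 0" "{}"] by (simp add: sum_aut_orbit)
  finally show "\<tau> x = 0" using order_pos by simp
qed

text \<open>The representative is \<open>lrep (snd x)\<close> itself, because the bracket is
  computed from this very element.\<close>

lemma g_carrierE:
  assumes "x \<in> carrier (g_alg S \<epsilon>)"
  obtains f where "f \<in> free_space S" "push_forward W f - f \<in> R" "lrep (snd x) = f"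
    "x = (\<lambda>_. 0, lclass S f)"
proof -
  obtain \<tau> A where x: "x = (\<tau>, A)" by (cases x)
  have *: "\<tau> \<in> t_space" "A \<in> l_space S" "w_lift S x = x"
    using assms by (auto simp: g_alg_def h_alg_def x)
  then have "\<tau> = (\<lambda>_. 0)" by (intro invariant_t_space) (auto simp: x w_lift_def)
  moreover note lrep_free_space[OF *(2)]
  ultimately show ?thesis
    using *(3) w_lift_lclass[of "lrep A"] by (intro that[of "lrep A"]) (auto simp: x)
qed

end

section \<open>The bracket on representatives and on invariant classes\<close>

context special_datum
begin

definition symbol_bracket :: "'l \<times> 'h \<Rightarrow> 'l \<times> 'h \<Rightarrow> ('l \<times> 'h \<Rightarrow>\<^sub>0 'k)" where
  "symbol_bracket a b =
     (if fst a + fst b \<in> roots S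
      then fscale (\<epsilon> (fst a) (fst b)) (Poly_Mapping.single (a \<otimes>\<^bsub>tilde_lattice S\<^esub> b) 1) else 0)"

text \<open>The toral component is evaluated at a fixed vector \<gamma>, which makes it a scalar and
  brings it under linear extension over k.\<close>

definition symbol_bracket_t :: "'l \<Rightarrow> 'l \<times> 'h \<Rightarrow> 'l \<times> 'h \<Rightarrow> 'k" where
  "symbol_bracket_t \<gamma> a b =
     (if fst a + fst b = 0
      then \<epsilon> (fst a) (fst b) * tilde_scalar S (a \<otimes>\<^bsub>tilde_lattice S\<^esub> b) * dual_vec S (fst a) \<gamma> else 0)"

lemma bracket_l_eq:
  "bracket_l S \<epsilon> f g = lin_ext fscale (\<lambda>a. lin_ext fscale (symbol_bracket a) g) f"
proof -
  interpret F: Modules.module "fscale :: 'k \<Rightarrow> ('l \<times> 'h \<Rightarrow>\<^sub>0 'k) \<Rightarrow> _" by (rule module_fscale)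
  show ?thesis
    unfolding bracket_l_def lin_ext_def F.scale_sum_right
    by (intro sum.cong refl) (simp add: symbol_bracket_def mult.assoc)
qed

lemma module_times: "Modules.module ((*) :: 'k \<Rightarrow> _)"
  by unfold_locales (auto simp: algebra_simps)

lemma bracket_t_eq:
  "bracket_t S \<epsilon> f g \<gamma> = lin_ext (*) (\<lambda>a. lin_ext (*) (symbol_bracket_t \<gamma> a) g) f"
  unfolding bracket_t_def lin_ext_def sum_distrib_left
  by (intro sum.cong refl) (simp add: symbol_bracket_t_def mult.assoc)

lemma symbol_bracket_zeta_mult:
  assumes a: "a \<in> X" and b: "b \<in> X"
  shows "symbol_bracket (zeta_mult a) b - fscale (zeta S) (symbol_bracket a b) \<in> R"
    and "symbol_bracket a (zeta_mult b) - fscale (zeta S) (symbol_bracket a b) \<in> R"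
proof -
  interpret F: Modules.module "fscale :: 'k \<Rightarrow> ('l \<times> 'h \<Rightarrow>\<^sub>0 'k) \<Rightarrow> _" by (rule module_fscale)
  let ?c = "a \<otimes>\<^bsub>tilde_lattice S\<^esub> b"
  have *: "fscale c (Poly_Mapping.single (zeta_mult ?c) 1) -
      fscale (zeta S) (fscale c (Poly_Mapping.single ?c 1)) \<in> R" if "fst a + fst b \<in> roots S" for c
  proof -
    have "fscale c (Poly_Mapping.single (zeta_mult ?c) 1 - fscale (zeta S) (Poly_Mapping.single ?c 1)) \<in> R"
      by (intro relations_scale relation_zeta_mult tilde_mult_root a b that)
    then show ?thesis
      by (simp only: F.scale_right_diff_distrib F.scale_scale mult.commute[of c])
  qed
  have "fst (zeta_mult a) = fst a" "fst (zeta_mult b) = fst b" by (simp_all add: zeta_mult_def)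
  then show "symbol_bracket (zeta_mult a) b - fscale (zeta S) (symbol_bracket a b) \<in> R"
    and "symbol_bracket a (zeta_mult b) - fscale (zeta S) (symbol_bracket a b) \<in> R"
    using * by (simp_all add: symbol_bracket_def zeta_mult_left[OF a b] zeta_mult_right[OF a b])
qed

lemma symbol_bracket_t_zeta_mult:
  assumes a: "a \<in> X" and b: "b \<in> X"
  shows "symbol_bracket_t \<gamma> (zeta_mult a) b = zeta S * symbol_bracket_t \<gamma> a b"
    and "symbol_bracket_t \<gamma> a (zeta_mult b) = zeta S * symbol_bracket_t \<gamma> a b"
proof -
  let ?c = "a \<otimes>\<^bsub>tilde_lattice S\<^esub> b"
  have *: "tilde_scalar S (zeta_mult ?c) = zeta S * tilde_scalar S ?c" if "fst a + fst b = 0"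
  proof (rule tilde_scalar_zeta_mult)
    show "snd ?c \<in> carrier H"
      using a b group_extgrp by (auto simp: tilde_roots_iff tilde_mult group_def monoid.m_closed)
    show "proj S (snd ?c) = \<one>\<^bsub>coinvariants S\<^esub>"
      using a b that coinv_class_add[of "fst a" "fst b"]
      by (simp add: tilde_roots_iff tilde_mult proj_mult coinv_class_0)
  qed
  have "fst (zeta_mult a) = fst a" "fst (zeta_mult b) = fst b" by (simp_all add: zeta_mult_def)
  then show "symbol_bracket_t \<gamma> (zeta_mult a) b = zeta S * symbol_bracket_t \<gamma> a b"
    and "symbol_bracket_t \<gamma> a (zeta_mult b) = zeta S * symbol_bracket_t \<gamma> a b"
    using * by (simp_all add: symbol_bracket_t_def zeta_mult_left[OF a b] zeta_mult_right[OF a b])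
qed

text \<open>One argument is changed at a time. Compatibility with \<zeta> is known for lifts of
  roots, so the argument held fixed must lie in the free space; \<open>f'\<close> does, since it
  differs from \<open>f\<close> by a relation.\<close>

lemma bracket_l_cong:
  assumes f: "f \<in> free_space S" "f - f' \<in> R" and g: "g \<in> free_space S" "g - g' \<in> R"
  shows "bracket_l S \<epsilon> f g - bracket_l S \<epsilon> f' g' \<in> R"
proof -
  interpret F: Modules.module "fscale :: 'k \<Rightarrow> ('l \<times> 'h \<Rightarrow>\<^sub>0 'k) \<Rightarrow> _" by (rule module_fscale)
  have f': "f' \<in> free_space S"
    using F.subspace_diff[OF subspace_free_space f(1), of "f - f'"] f(2) relations_subset_free_space
    by auto
  have "lin_ext fscale (\<lambda>a. lin_ext fscale (symbol_bracket a) g) (f - f') \<in> R"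
    by (rule lin_ext_relations[OF module_fscale subspace_relations _ f(2)])
       (auto simp: F.scale_lin_ext F.lin_ext_diff_fun[symmetric] dest: free_space_keys[OF g(1)]
         intro!: F.lin_ext_in_subspace[OF subspace_relations] symbol_bracket_zeta_mult)
  then have 1: "bracket_l S \<epsilon> f g - bracket_l S \<epsilon> f' g \<in> R"
    unfolding bracket_l_eq by (simp only: lin_ext_diff[OF module_fscale])
  have "lin_ext fscale (\<lambda>b. lin_ext fscale (\<lambda>a. symbol_bracket a b) f') (g - g') \<in> R"
    by (rule lin_ext_relations[OF module_fscale subspace_relations _ g(2)])
       (auto simp: F.scale_lin_ext F.lin_ext_diff_fun[symmetric] dest: free_space_keys[OF f']
         intro!: F.lin_ext_in_subspace[OF subspace_relations] symbol_bracket_zeta_mult)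
  then have 2: "bracket_l S \<epsilon> f' g - bracket_l S \<epsilon> f' g' \<in> R"
    unfolding bracket_l_eq F.lin_ext_swap[of _ _ f'] by (simp only: lin_ext_diff[OF module_fscale])
  show ?thesis using relations_add[OF 1 2] by simp
qed

lemma bracket_t_cong:
  assumes f: "f \<in> free_space S" "f - f' \<in> R" and g: "g \<in> free_space S" "g - g' \<in> R"
  shows "bracket_t S \<epsilon> f g = bracket_t S \<epsilon> f' g'"
proof
  fix \<gamma>
  interpret K: Modules.module "(*) :: 'k \<Rightarrow> 'k \<Rightarrow> 'k" by (rule module_times)
  interpret F: Modules.module "fscale :: 'k \<Rightarrow> ('l \<times> 'h \<Rightarrow>\<^sub>0 'k) \<Rightarrow> _" by (rule module_fscale)
  have f': "f' \<in> free_space S"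
    using F.subspace_diff[OF subspace_free_space f(1), of "f - f'"] f(2) relations_subset_free_space
    by auto
  have "lin_ext (*) (\<lambda>a. lin_ext (*) (symbol_bracket_t \<gamma> a) g) f
      = lin_ext (*) (\<lambda>a. lin_ext (*) (symbol_bracket_t \<gamma> a) g) f'"
    by (rule lin_ext_cong_relations[OF module_times _ f(2)])
       (auto simp: K.scale_lin_ext dest: free_space_keys[OF g(1)]
         intro!: lin_ext_cong symbol_bracket_t_zeta_mult)
  also have "\<dots> = lin_ext (*) (\<lambda>a. lin_ext (*) (symbol_bracket_t \<gamma> a) g') f'"
    unfolding K.lin_ext_swap[of _ _ f']
    by (rule lin_ext_cong_relations[OF module_times _ g(2)])
       (auto simp: K.scale_lin_ext dest: free_space_keys[OF f']
         intro!: lin_ext_cong symbol_bracket_t_zeta_mult)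
  finally show "bracket_t S \<epsilon> f g \<gamma> = bracket_t S \<epsilon> f' g' \<gamma>" by (simp only: bracket_t_eq)
qed

lemma tilde_mult_aut:
  "W a \<otimes>\<^bsub>tilde_lattice S\<^esub> W b = W (a \<otimes>\<^bsub>tilde_lattice S\<^esub> b)"
  by (simp add: tilde_mult tilde_aut_def aut_add)

lemma aut_root_iff: "w a \<in> roots S \<longleftrightarrow> a \<in> roots S"
  by (simp add: roots_def)

lemma aut_eq_0_iff: "w a = 0 \<longleftrightarrow> a = 0"
  using bij_aut by (metis aut_0 bij_is_inj injD)

text \<open>Holds exactly and not just modulo relations: w preserves \<epsilon> and the set of
  roots, and it is multiplicative on the extension of the lattice.\<close>

lemma bracket_l_push_forward:
  "bracket_l S \<epsilon> (push_forward W f) (push_forward W g) = push_forward W (bracket_l S \<epsilon> f g)"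
proof -
  have "push_forward W (Poly_Mapping.single c (1 :: 'k)) = Poly_Mapping.single (W c) 1" for c
    by (simp add: push_forward_def fscale_single)
  moreover have "push_forward W (0 :: 'l \<times> 'h \<Rightarrow>\<^sub>0 'k) = 0" by (simp add: push_forward_def)
  moreover have "push_forward W (fscale c h) = fscale c (push_forward W h)"
    for c and h :: "'l \<times> 'h \<Rightarrow>\<^sub>0 'k"
    unfolding push_forward_eq by (rule lin_ext_scale[OF module_fscale])
  moreover have "fst (W a) + fst (W b) = w (fst a + fst b)" "\<epsilon> (fst (W a)) (fst (W b)) = \<epsilon> (fst a) (fst b)"
    for a b by (simp_all add: tilde_aut_def aut_add)
  ultimately have push: "push_forward W (symbol_bracket a b) = symbol_bracket (W a) (W b)" for a b
    by (simp add: symbol_bracket_def tilde_mult_aut aut_root_iff)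
  have hom: "Modules.module_hom fscale fscale (push_forward W :: ('l \<times> 'h \<Rightarrow>\<^sub>0 'k) \<Rightarrow> _)"
    using module_hom_lin_ext[OF module_fscale] by (simp add: push_forward_eq[abs_def])
  show ?thesis
    unfolding bracket_l_eq lin_ext_push_forward[OF module_fscale] module_hom_apply_lin_ext[OF hom] push ..
qed

lemma form_inv_aut: "B (w x) y = B x (Hilbert_Choice.inv w y)"
  using form_aut[of x "Hilbert_Choice.inv w y"] bij_aut by (simp add: bij_is_surj surj_f_inv_f)

lemma bracket_t_push_forward:
  "bracket_t S \<epsilon> (push_forward W f) (push_forward W g) = bracket_t S \<epsilon> f g \<circ> Hilbert_Choice.inv w"
proof
  fix \<gamma>
  have "symbol_bracket_t \<gamma> (W a) (W b) = symbol_bracket_t (Hilbert_Choice.inv w \<gamma>) a b" for a b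
    by (simp add: symbol_bracket_t_def tilde_mult_aut tilde_scalar_def)
       (simp add: tilde_aut_def aut_add[symmetric] aut_eq_0_iff dual_vec_def form_inv_aut)
  then show "bracket_t S \<epsilon> (push_forward W f) (push_forward W g) \<gamma>
      = (bracket_t S \<epsilon> f g \<circ> Hilbert_Choice.inv w) \<gamma>"
    by (simp add: bracket_t_eq lin_ext_push_forward[OF module_times])
qed

lemma bracket_t_space: "bracket_t S \<epsilon> f g \<in> t_space"
  unfolding t_space_def bracket_t_def
  by (auto simp: sum.distrib[symmetric] dual_vec_def form_add_right algebra_simps intro!: sum.cong)

lemma bracket_l_free_space:
  assumes "f \<in> free_space S" "g \<in> free_space S"
  shows "bracket_l S \<epsilon> f g \<in> free_space S"
proof -
  have sb: "symbol_bracket a b \<in> free_space S" if "a \<in> X" "b \<in> X" for a b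
    using that tilde_mult_root[of a b] module.subspace_scale[OF module_fscale subspace_free_space]
      module.subspace_0[OF module_fscale subspace_free_space]
    by (auto simp: symbol_bracket_def intro!: single_free_space)
  show ?thesis unfolding bracket_l_eq
    using assms
    by (auto intro!: module.lin_ext_in_subspace[OF module_fscale subspace_free_space] sb
        intro: free_space_keys)
qed

text \<open>The toral component of the bracket is w-invariant, hence zero, so the terms with
  opposite roots never have to be summed explicitly. The assumptions on \<open>lrep\<close> allow
  the bracket to be unfolded at \<open>f\<close> and \<open>g\<close> directly.\<close>

lemma g_bracket:
  assumes f: "f \<in> free_space S" "push_forward W f - f \<in> R" "lrep (lclass S f) = f"
    and g: "g \<in> free_space S" "push_forward W g - g \<in> R" "lrep (lclass S g) = g"
  shows "bracket (g_alg S \<epsilon>) (\<lambda>_. 0, lclass S f) (\<lambda>_. 0, lclass S g)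
           = (\<lambda>_. 0, lclass S (bracket_l S \<epsilon> f g))"
    and "bracket_l S \<epsilon> f g \<in> free_space S"
    and "push_forward W (bracket_l S \<epsilon> f g) - bracket_l S \<epsilon> f g \<in> R"
proof -
  note free = push_forward_free_space[OF f(1), of 1] push_forward_free_space[OF g(1), of 1]
  have "bracket_t S \<epsilon> f g \<circ> Hilbert_Choice.inv w = bracket_t S \<epsilon> f g"
    unfolding bracket_t_push_forward[symmetric] using free f g by (intro bracket_t_cong) simp_all
  then have "bracket_t S \<epsilon> f g = (\<lambda>_. 0)" by (rule invariant_t_space[OF bracket_t_space])
  moreover have "t_action (\<lambda>_. 0) h = 0" for h :: "'l \<times> 'h \<Rightarrow>\<^sub>0 'k"
    by (simp add: t_action_def module.scale_zero_left[OF module_fscale])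
  ultimately show "bracket (g_alg S \<epsilon>) (\<lambda>_. 0, lclass S f) (\<lambda>_. 0, lclass S g)
           = (\<lambda>_. 0, lclass S (bracket_l S \<epsilon> f g))"
    by (simp add: g_alg_def h_alg_def f g)
  show "push_forward W (bracket_l S \<epsilon> f g) - bracket_l S \<epsilon> f g \<in> R"
    unfolding bracket_l_push_forward[symmetric] using free f g by (intro bracket_l_cong) simp_all
  show "bracket_l S \<epsilon> f g \<in> free_space S"
    by (rule bracket_l_free_space[OF f(1) g(1)])
qed

end

section \<open>The representation\<close>

locale rep_datum = special_datum S
  for S :: "('l::ab_group_add, 'k::field_char_0, 'h) setup_data" +
  fixes e :: "'k \<Rightarrow> 'K::field"
    and s :: "'K \<Rightarrow> 'v::ab_group_add \<Rightarrow> 'v"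
    and \<rho> :: "'h \<Rightarrow> 'v \<Rightarrow> 'v"
  assumes emb: "field_embedding e"
    and vec: "vector_space s"
    and rho_hom: "\<rho> \<in> hom H (general_linear_group s)"
    and rho_zeta: "\<rho> (incl S (zeta S)) v = s (e (zeta S)) v"
begin

interpretation V: vector_space s by (rule vec)

abbreviation "scl c v \<equiv> s (e c) v"
abbreviation "\<gg> \<equiv> g_alg S \<epsilon>"

lemma emb_simps [simp]: "e 1 = 1" "e (x + y) = e x + e y" "e (x * y) = e x * e y"
  using emb by (auto simp: field_embedding_def)

lemma emb_0 [simp]: "e 0 = 0"
  using emb by (metis add_0 add_cancel_right_right field_embedding_def)

lemma module_scl: "Modules.module scl"
  by unfold_locales (auto simp: V.scale_right_distrib V.scale_left_distrib)

lemma rho_linear: "h \<in> carrier H \<Longrightarrow> Vector_Spaces.linear s s (\<rho> h)"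
  using rho_hom by (auto simp: hom_def general_linear_group_def)

lemma rho_mult: "h \<in> carrier H \<Longrightarrow> h' \<in> carrier H \<Longrightarrow> \<rho> (h \<otimes>\<^bsub>H\<^esub> h') v = \<rho> h (\<rho> h' v)"
  using rho_hom by (auto simp: hom_def general_linear_group_def)

lemma rho_scale: "h \<in> carrier H \<Longrightarrow> \<rho> h (s c v) = s c (\<rho> h v)"
  using rho_linear[of h] by (simp add: Vector_Spaces.linear_iff)

lemma rho_module_hom: "h \<in> carrier H \<Longrightarrow> Modules.module_hom scl scl (\<rho> h)"
  using rho_linear[of h]
  by (intro module_hom.intro module_scl module_hom_axioms.intro rho_scale)
     (simp_all add: Vector_Spaces.linear_iff)

lemma rho_incl:
  assumes "z \<in> carrier (mu S)"
  shows "\<rho> (incl S z) v = scl z v"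
proof -
  have "\<rho> (incl S (zeta S ^ n)) v = scl (zeta S ^ n) v" for n
  proof (induction n arbitrary: v)
    case 0
    \<comment> \<open>The operator of the unit is idempotent and injective, hence the
      identity.\<close>
    have "bij (\<rho> \<one>\<^bsub>H\<^esub>)" and "\<one>\<^bsub>H\<^esub> \<in> carrier H"
      using rho_hom group_extgrp by (auto simp: hom_def general_linear_group_def group_def monoid.one_closed)
    moreover have "\<rho> \<one>\<^bsub>H\<^esub> (\<rho> \<one>\<^bsub>H\<^esub> v) = \<rho> \<one>\<^bsub>H\<^esub> v"
      using rho_mult[of "\<one>\<^bsub>H\<^esub>" "\<one>\<^bsub>H\<^esub>" v] group_extgrp by (simp add: group_def monoid.one_closed monoid.l_one)
    ultimately have "\<rho> \<one>\<^bsub>H\<^esub> v = v" by (simp add: bij_is_inj inj_eq)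
    then show ?case by simp
  next
    case (Suc n)
    have "zeta S ^ n \<in> carrier (mu S)" by (auto simp: mu_def)
    then show ?case using Suc by (simp add: incl_mult rho_mult rho_zeta)
  qed
  then show ?thesis using assms by (auto simp: mu_def)
qed

text \<open>The linear extension of a |-> \<rho>(\<pi>(a)) to all formal combinations, invariant or
  not. Since w does not move the component in the extension group, an orbit sum over d terms
  receives d equal contributions; this is the origin of the factor 1/d.\<close>

definition L :: "('l \<times> 'h \<Rightarrow>\<^sub>0 'k) \<Rightarrow> 'v \<Rightarrow> 'v" where
  "L f v = lin_ext scl (\<lambda>a. \<rho> (snd a) v) f"

lemma rho_zeta_mult: "a \<in> X \<Longrightarrow> \<rho> (snd (zeta_mult a)) v = scl (zeta S) (\<rho> (snd a) v)"
  by (simp add: zeta_mult_def rho_mult rho_zeta tilde_roots_iff)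

lemma L_cong: "f - g \<in> R \<Longrightarrow> L f = L g"
  unfolding L_def[abs_def]
  by (intro ext lin_ext_cong_relations[OF module_scl]) (auto simp: rho_zeta_mult)

lemma L_add: "L (f + g) v = L f v + L g v"
  unfolding L_def by (rule module.lin_ext_add[OF module_scl])

lemma L_fscale: "L (fscale c f) v = scl c (L f v)"
  unfolding L_def by (rule lin_ext_scale[OF module_scl])

lemma L_linear: "f \<in> free_space S \<Longrightarrow> Vector_Spaces.linear s s (L f)"
proof -
  assume f: "f \<in> free_space S"
  have "L f (u + v) = L f u + L f v" for u v
    unfolding L_def module.lin_ext_add_fun[OF module_scl, symmetric]
    using f by (intro lin_ext_cong) (auto simp: tilde_roots_iff module_hom.add[OF rho_module_hom] dest: free_space_keys)
  moreover have "L f (s c v) = s c (L f v)" for c v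
    unfolding L_def lin_ext_def V.scale_sum_right
    using f by (intro sum.cong) (auto simp: tilde_roots_iff rho_scale mult.commute dest: free_space_keys)
  ultimately show ?thesis
    using vec by (intro Vector_Spaces.linear_iff[THEN iffD2]) auto
qed

section \<open>Orbit sums and the elements Z\<close>

definition orb :: "('l \<times> 'h \<Rightarrow>\<^sub>0 'k) \<Rightarrow> ('l \<times> 'h \<Rightarrow>\<^sub>0 'k)" where
  "orb f = (\<Sum>j<d. push_forward (W ^^ j) f)"

lemma orb_free_space: "f \<in> free_space S \<Longrightarrow> orb f \<in> free_space S"
  unfolding orb_def
  by (intro module.subspace_sum[OF module_fscale subspace_free_space] push_forward_free_space)

lemma push_forward_orb: "push_forward W (orb f) = orb f"
proof -
  have *: "push_forward (W ^^ d) f = push_forward (W ^^ 0) f"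
    by (simp add: push_forward_def funpow_tilde_aut aut_pow_order)
  have "push_forward W (orb f) = (\<Sum>j<d. push_forward (W ^^ Suc j) f)"
    unfolding orb_def push_forward_eq[of W] module.lin_ext_sum[OF module_fscale]
    by (simp add: push_forward_eq[symmetric] push_forward_comp)
  also have "\<dots> = orb f"
    using sum.lessThan_Suc_shift[of "\<lambda>j. push_forward (W ^^ j) f" d]
      sum.lessThan_Suc[of "\<lambda>j. push_forward (W ^^ j) f" d]
    unfolding orb_def * by (simp only: add.commute add_left_cancel)
  finally show ?thesis .
qed

lemma push_forward_add: "push_forward u (f + g) = push_forward u f + push_forward u g"
  unfolding push_forward_eq by (rule module.lin_ext_add[OF module_fscale])

lemma push_forward_fscale: "push_forward u (fscale c f) = fscale c (push_forward u f)"
  unfolding push_forward_eq by (rule lin_ext_scale[OF module_fscale])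

lemma orb_add: "orb (f + g) = orb f + orb g"
  by (simp add: orb_def push_forward_add sum.distrib)

lemma orb_fscale: "orb (fscale c f) = fscale c (orb f)"
  by (simp add: orb_def push_forward_fscale module.scale_sum_right[OF module_fscale])

lemma orb_single: "orb (Poly_Mapping.single a 1) = (\<Sum>j<d. Poly_Mapping.single ((W ^^ j) a) 1)"
  by (simp add: orb_def push_forward_def fscale_single)

text \<open>Modulo \<open>R\<close>, an invariant combination agrees with each of its d translates
  and therefore with their mean; division by d uses characteristic zero. Consequently the elements Z
  span the fixed algebra.\<close>

lemma orb_invariant:
  assumes "push_forward W f - f \<in> R"
  shows "f - orb (fscale (1 / of_nat d) f) \<in> R"
proof -
  interpret F: Modules.module "fscale :: 'k \<Rightarrow> ('l \<times> 'h \<Rightarrow>\<^sub>0 'k) \<Rightarrow> _" by (rule module_fscale)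
  have d: "(of_nat d :: 'k) \<noteq> 0" using order_pos by simp
  have "(\<Sum>j<d. f - push_forward (W ^^ j) f) \<in> R"
    using relations_scale[OF push_forward_funpow_relations[OF assms], of "-1"]
    by (intro relations_sum) (simp add: F.scale_minus_left)
  then have "fscale (of_nat d) f - orb f \<in> R"
    by (simp add: orb_def sum_subtractf F.sum_constant_scale del: sum_constant)
  then have "fscale (1 / of_nat d) (fscale (of_nat d) f - orb f) \<in> R" by (rule relations_scale)
  then show ?thesis using d by (simp add: F.scale_right_diff_distrib orb_fscale)
qed

definition Zmap :: "('l \<times> 'h \<Rightarrow>\<^sub>0 'k) \<Rightarrow> ('l, 'k, 'h) h_elem" where
  "Zmap f = (\<lambda>_. 0, lclass S (orb f))"

lemma Zmap_carrier: "f \<in> free_space S \<Longrightarrow> Zmap f \<in> carrier \<gg>"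
  unfolding Zmap_def by (intro g_carrierI orb_free_space) (simp_all add: push_forward_orb)

lemma Zmap_single: "Zmap (Poly_Mapping.single a 1) = Z_elem S a"
  by (simp add: Zmap_def Z_elem_def orb_single)

lemma vadd_lclass:
  "vadd \<gg> (\<lambda>_. 0, lclass S f) (\<lambda>_. 0, lclass S g) = (\<lambda>_. 0, lclass S (f + g))"
  using relations_add[OF lrep_lclass[of f] lrep_lclass[of g]]
  by (simp add: g_alg_def h_alg_def lclass_eq_iff algebra_simps)

lemma vscale_lclass:
  "vscale \<gg> c (\<lambda>_. 0, lclass S f) = (\<lambda>_. 0, lclass S (fscale c f))"
  using relations_scale[OF lrep_lclass[of f], of c]
  by (simp add: g_alg_def h_alg_def lclass_eq_iff module.scale_right_diff_distrib[OF module_fscale])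

section \<open>Existence and uniqueness of the linear map\<close>

lemma free_space_induct [consumes 1, case_names single add scale zero]:
  assumes f: "f \<in> free_space S"
    and single: "\<And>a. a \<in> X \<Longrightarrow> P (Poly_Mapping.single a 1)"
    and add: "\<And>f g. f \<in> free_space S \<Longrightarrow> g \<in> free_space S \<Longrightarrow> P f \<Longrightarrow> P g \<Longrightarrow> P (f + g)"
    and scale: "\<And>c f. f \<in> free_space S \<Longrightarrow> P f \<Longrightarrow> P (fscale c f)"
    and zero: "P 0"
  shows "P f"
proof -
  have f_eq: "f = (\<Sum>a\<in>Poly_Mapping.keys f. fscale (Poly_Mapping.lookup f a) (Poly_Mapping.single a 1))"
    by (intro poly_mapping_eqI) (auto simp: fscale_single lookup_sum lookup_single when_def in_keys_iff)
  have "(\<Sum>a\<in>A. fscale (c a) (Poly_Mapping.single a 1)) \<in> free_space S \<and>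
      P (\<Sum>a\<in>A. fscale (c a) (Poly_Mapping.single a 1))" if "finite A" "A \<subseteq> X" for A and c :: "_ \<Rightarrow> 'k"
    using that
  proof (induction A rule: finite_induct)
    case empty
    then show ?case using zero module.subspace_0[OF module_fscale subspace_free_space] by simp
  next
    case (insert a A)
    then have a: "fscale (c a) (Poly_Mapping.single a 1) \<in> free_space S"
      "P (fscale (c a) (Poly_Mapping.single a 1))"
      using single scale by (auto simp: single_free_space module.subspace_scale[OF module_fscale subspace_free_space])
    then show ?case
      using insert add module.subspace_add[OF module_fscale subspace_free_space] by simp
  qed
  from this[of "Poly_Mapping.keys f" "Poly_Mapping.lookup f"] show ?thesis
    using f f_eq by (simp add: free_space_def)
qed

text \<open>\<open>Zmap\<close> extends a |-> Z_a linearly, so both sides are linear in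
  \<open>f\<close> and agree on symbols. As \<open>Zmap\<close> reaches every element of the fixed
  algebra, this determines \<open>r\<close>.\<close>

lemma rho_tilde_Zmap:
  assumes r: "rho_tilde_map S \<epsilon> e s \<rho> r" and f: "f \<in> free_space S"
  shows "r (Zmap f) = L f"
proof -
  have lin: "linear_map \<gg> (gl_alg e s) r" and Z: "\<And>a. a \<in> X \<Longrightarrow> r (Z_elem S a) = \<rho> (snd a)"
    using r by (auto simp: rho_tilde_map_def)
  have r_scale: "r (Zmap (fscale c g)) = (\<lambda>v. scl c (r (Zmap g) v))" if "g \<in> free_space S" for c g
  proof -
    have "r (vscale \<gg> c (Zmap g)) = (\<lambda>v. scl c (r (Zmap g) v))"
      using lin Zmap_carrier[OF that] by (simp add: linear_map_def gl_alg_def)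
    then show ?thesis by (simp only: Zmap_def orb_fscale vscale_lclass)
  qed
  show ?thesis using f
  proof (induction f rule: free_space_induct)
    case (single a)
    then show ?case
      by (simp add: Zmap_single Z L_def[abs_def] module.lin_ext_single[OF module_scl])
  next
    case (add f g)
    have "r (vadd \<gg> (Zmap f) (Zmap g)) = (\<lambda>v. r (Zmap f) v + r (Zmap g) v)"
      using lin Zmap_carrier[OF add(1)] Zmap_carrier[OF add(2)]
      by (simp add: linear_map_def gl_alg_def)
    then have "r (Zmap (f + g)) = (\<lambda>v. r (Zmap f) v + r (Zmap g) v)"
      by (simp only: Zmap_def orb_add vadd_lclass)
    then show ?case using add by (simp add: L_add fun_eq_iff)
  next
    case (scale c f)
    then show ?case using r_scale by (simp add: L_fscale fun_eq_iff)
  next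
    case zero
    \<comment> \<open>\<open>linear_map\<close> has no clause for zero, so 0 is treated as the
      scalar multiple 0 * 0.\<close>
    have "0 \<in> free_space S" by (rule module.subspace_0[OF module_fscale subspace_free_space])
    then have "r (Zmap (fscale 0 0)) = L (fscale 0 0)"
      by (simp add: r_scale L_fscale fun_eq_iff emb_0)
    then show ?case by (simp add: module.scale_zero_left[OF module_fscale])
  qed
qed

text \<open>A closed formula in place of values on a spanning set: independence of the
  representative follows from compatibility of \<open>L\<close> with the relations, and no basis has
  to be selected among the elements Z.\<close>

definition rho_tilde :: "('l, 'k, 'h) h_elem \<Rightarrow> 'v \<Rightarrow> 'v" where
  "rho_tilde x = L (fscale (1 / of_nat d) (lrep (snd x)))"

lemma rho_tilde_lclass: "rho_tilde (\<tau>, lclass S f) = L (fscale (1 / of_nat d) f)"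
  by (simp add: rho_tilde_def L_fscale fun_eq_iff L_cong[OF lrep_lclass])

lemma rho_tilde_map_unique:
  assumes r: "rho_tilde_map S \<epsilon> e s \<rho> r" and x: "x \<in> carrier \<gg>"
  shows "r x = rho_tilde x"
  using x
proof (rule g_carrierE)
  fix f assume f: "f \<in> free_space S" "push_forward W f - f \<in> R" "x = (\<lambda>_. 0, lclass S f)"
  let ?f = "fscale (1 / of_nat d) f"
  have "x = Zmap ?f"
    using orb_invariant[OF f(2)] by (simp add: Zmap_def f(3) lclass_eq_iff)
  then have "r x = L ?f"
    using rho_tilde_Zmap[OF r, of ?f] f(1) module.subspace_scale[OF module_fscale subspace_free_space] by simp
  then show ?thesis by (simp add: f(3) rho_tilde_lclass)
qed

lemma push_forward_id_relations_add:
  assumes "push_forward W f - f \<in> R" "push_forward W g - g \<in> R"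
  shows "push_forward W (f + g) - (f + g) \<in> R"
  using relations_add[OF assms] by (simp add: push_forward_add algebra_simps)

lemma push_forward_id_relations_fscale:
  assumes "push_forward W f - f \<in> R"
  shows "push_forward W (fscale c f) - fscale c f \<in> R"
  using relations_scale[OF assms, of c]
  by (simp add: push_forward_fscale module.scale_right_diff_distrib[OF module_fscale])

lemma vadd_closed: "x \<in> carrier \<gg> \<Longrightarrow> y \<in> carrier \<gg> \<Longrightarrow> vadd \<gg> x y \<in> carrier \<gg>"
  and rho_tilde_vadd:
    "x \<in> carrier \<gg> \<Longrightarrow> y \<in> carrier \<gg> \<Longrightarrow> rho_tilde (vadd \<gg> x y) v = rho_tilde x v + rho_tilde y v"
proof -
  assume "x \<in> carrier \<gg>" "y \<in> carrier \<gg>"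
  from this(1) obtain f where f: "f \<in> free_space S" "push_forward W f - f \<in> R" "x = (\<lambda>_. 0, lclass S f)"
    by (rule g_carrierE)
  from \<open>y \<in> carrier \<gg>\<close> obtain g where g: "g \<in> free_space S" "push_forward W g - g \<in> R" "y = (\<lambda>_. 0, lclass S g)"
    by (rule g_carrierE)
  show "vadd \<gg> x y \<in> carrier \<gg>"
    unfolding f g vadd_lclass
    by (intro g_carrierI push_forward_id_relations_add f g module.subspace_add[OF module_fscale subspace_free_space])
  show "rho_tilde (vadd \<gg> x y) v = rho_tilde x v + rho_tilde y v"
    unfolding f g vadd_lclass rho_tilde_lclass by (simp add: L_fscale L_add V.scale_right_distrib)
qed

lemma vscale_closed: "x \<in> carrier \<gg> \<Longrightarrow> vscale \<gg> c x \<in> carrier \<gg>"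
  and rho_tilde_vscale: "x \<in> carrier \<gg> \<Longrightarrow> rho_tilde (vscale \<gg> c x) v = scl c (rho_tilde x v)"
proof -
  assume "x \<in> carrier \<gg>"
  then obtain f where f: "f \<in> free_space S" "push_forward W f - f \<in> R" "x = (\<lambda>_. 0, lclass S f)"
    by (rule g_carrierE)
  show "vscale \<gg> c x \<in> carrier \<gg>"
    unfolding f vscale_lclass
    by (intro g_carrierI push_forward_id_relations_fscale f module.subspace_scale[OF module_fscale subspace_free_space])
  show "rho_tilde (vscale \<gg> c x) v = scl c (rho_tilde x v)"
    unfolding f vscale_lclass rho_tilde_lclass by (simp add: L_fscale mult.commute)
qed

lemma rho_tilde_linear: "x \<in> carrier \<gg> \<Longrightarrow> Vector_Spaces.linear s s (rho_tilde x)"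
  by (erule g_carrierE)
     (auto simp: rho_tilde_lclass intro!: L_linear module.subspace_scale[OF module_fscale subspace_free_space])

lemma rho_tilde_Z_elem:
  assumes a: "a \<in> X"
  shows "rho_tilde (Z_elem S a) = \<rho> (snd a)"
proof
  fix v
  have d: "(of_nat d :: 'k) \<noteq> 0" using order_pos by simp
  have "L (\<Sum>j<d. Poly_Mapping.single ((W ^^ j) a) 1) v = (\<Sum>j<d. \<rho> (snd a) v)"
    unfolding L_def module.lin_ext_sum[OF module_scl] module.lin_ext_single[OF module_scl]
    by (simp add: funpow_tilde_aut)
  also have "\<dots> = scl (of_nat d) (\<rho> (snd a) v)"
    using module.sum_constant_scale[OF module_scl, of "\<rho> (snd a) v" "{..<d}"] by simp
  \<comment> \<open>Multiplicativity of the embedding is used from right to left, so that 1/d and d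
    cancel already in k, where d is nonzero.\<close>
  finally show "rho_tilde (Z_elem S a) v = \<rho> (snd a) v"
    using d by (simp add: Z_elem_def rho_tilde_lclass L_fscale emb_simps(3)[symmetric] del: emb_simps(3))
qed

lemma rho_tilde_map_restrict: "rho_tilde_map S \<epsilon> e s \<rho> (restrict rho_tilde (carrier \<gg>))"
proof -
  have "Z_elem S a \<in> carrier \<gg>" if "a \<in> X" for a
    using Zmap_carrier[OF single_free_space[OF that, of 1]] by (simp add: Zmap_single)
  then show ?thesis
    by (auto simp: rho_tilde_map_def linear_map_def gl_alg_def vadd_closed vscale_closed rho_tilde_vadd
        rho_tilde_vscale rho_tilde_linear rho_tilde_Z_elem)
qed

text \<open>Reordering the two lifts costs the central factor given by the pairing of b with a, and
  \<rho> turns it into a scalar. This accounts for the right-hand side of the scalar identity for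
  the orbit sum.\<close>

lemma rho_commutator:
  assumes a: "a \<in> X" and b: "b \<in> X"
  shows "\<rho> (snd a) (\<rho> (snd b) v) - \<rho> (snd b) (\<rho> (snd a) v)
       = scl (1 - lattice_pairing S (fst b) (fst a)) (\<rho> (snd a \<otimes>\<^bsub>H\<^esub> snd b) v)"
proof -
  have ab: "snd a \<in> carrier H" "proj S (snd a) = cls (fst a)" "snd b \<in> carrier H" "proj S (snd b) = cls (fst b)"
    using a b by (auto simp: tilde_roots_iff)
  note comm = lattice_pairing_commutator[OF ab(3,4,1,2)]
  have H: "snd a \<otimes>\<^bsub>H\<^esub> snd b \<in> carrier H" using ab group_extgrp by (simp add: group_def monoid.m_closed)
  have "\<rho> (snd b) (\<rho> (snd a) v) = \<rho> (snd b \<otimes>\<^bsub>H\<^esub> snd a) v"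
    using ab by (simp add: rho_mult)
  also have "\<dots> = scl (lattice_pairing S (fst b) (fst a)) (\<rho> (snd a \<otimes>\<^bsub>H\<^esub> snd b) v)"
    unfolding comm(2) using comm(1) H by (simp add: rho_mult rho_incl)
  finally have "\<rho> (snd b) (\<rho> (snd a) v) = scl (lattice_pairing S (fst b) (fst a)) (\<rho> (snd a \<otimes>\<^bsub>H\<^esub> snd b) v)" .
  then show ?thesis
    using ab module.scale_left_diff_distrib[OF module_scl, of 1 "lattice_pairing S (fst b) (fst a)"]
    by (simp add: rho_mult)
qed

text \<open>The vector obtained by applying \<open>L (symbol_bracket a b)\<close> to
  \<open>v\<close>.\<close>

definition rho_bracket :: "'v \<Rightarrow> 'l \<times> 'h \<Rightarrow> 'l \<times> 'h \<Rightarrow> 'v" where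
  "rho_bracket v a b =
     (if fst a + fst b \<in> roots S
      then scl (\<epsilon> (fst a) (fst b)) (\<rho> (snd a \<otimes>\<^bsub>H\<^esub> snd b) v) else 0)"

lemma L_bracket_l: "L (bracket_l S \<epsilon> f g) v = lin_ext scl (\<lambda>a. lin_ext scl (rho_bracket v a) g) f"
proof -
  let ?T = "\<lambda>h. L h v"
  have hom: "Modules.module_hom fscale scl ?T"
    unfolding L_def by (rule module_hom_lin_ext[OF module_scl])
  have "?T (symbol_bracket a b) = rho_bracket v a b" for a b
    using module_hom.zero[OF hom]
    by (simp add: symbol_bracket_def rho_bracket_def L_fscale)
       (simp add: L_def module.lin_ext_single[OF module_scl] tilde_mult)
  then show ?thesis
    unfolding bracket_l_eq module_hom_apply_lin_ext[OF hom] by simp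
qed

text \<open>Only the lattice component of a moves along the orbit, so the operator of the product of
  the lifts is a common factor. Its coefficients are summed by \<open>sum_eps_orbit\<close>, and the
  result matches the commutator.\<close>

lemma sum_rho_bracket:
  assumes a: "a \<in> X" and b: "b \<in> X"
  shows "(\<Sum>j<d. rho_bracket v ((W ^^ j) a) b) = \<rho> (snd a) (\<rho> (snd b) v) - \<rho> (snd b) (\<rho> (snd a) v)"
proof -
  have ab: "fst a \<in> roots S" "fst b \<in> roots S" using a b by (auto simp: tilde_roots_iff)
  have "(\<Sum>j<d. rho_bracket v ((W ^^ j) a) b)
      = (\<Sum>j<d. scl (if B ((w ^^ j) (fst a)) (fst b) = -1 then \<epsilon> ((w ^^ j) (fst a)) (fst b) else 0)
           (\<rho> (snd a \<otimes>\<^bsub>H\<^esub> snd b) v))"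
    using ab by (intro sum.cong refl) (simp add: rho_bracket_def funpow_tilde_aut root_add_iff)
  also have "\<dots> = scl (\<Sum>j<d. if B ((w ^^ j) (fst a)) (fst b) = -1 then \<epsilon> ((w ^^ j) (fst a)) (fst b) else 0)
           (\<rho> (snd a \<otimes>\<^bsub>H\<^esub> snd b) v)"
    by (rule module.scale_sum_left[OF module_scl, symmetric])
  finally show ?thesis by (simp only: sum_eps_orbit[OF ab] rho_commutator[OF a b])
qed

text \<open>As the class of \<open>f\<close> is \<open>w\<close>-invariant, the bracket with \<open>f\<close> may be averaged over the orbits of the
  symbols in \<open>f\<close> alone.\<close>

lemma L_bracket:
  assumes f: "f \<in> free_space S" "push_forward W f - f \<in> R" and g: "g \<in> free_space S"
  shows "scl (of_nat d) (L (bracket_l S \<epsilon> f g) v) = L f (L g v) - L g (L f v)"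
proof -
  interpret M: Modules.module scl by (rule module_scl)
  have "L (bracket_l S \<epsilon> f g) v = lin_ext scl (\<lambda>a. lin_ext scl (rho_bracket v ((W ^^ j) a)) g) f" for j
  proof -
    have "L (bracket_l S \<epsilon> f g) v = L (bracket_l S \<epsilon> (push_forward (W ^^ j) f) g) v"
      using L_cong[OF bracket_l_cong[OF push_forward_free_space[OF f(1)]
            push_forward_funpow_relations[OF f(2)] g, of g j]] by simp
    then show ?thesis by (simp only: L_bracket_l lin_ext_push_forward[OF module_scl])
  qed
  then have "scl (of_nat d) (L (bracket_l S \<epsilon> f g) v)
      = (\<Sum>j<d. lin_ext scl (\<lambda>a. lin_ext scl (rho_bracket v ((W ^^ j) a)) g) f)"
    using M.sum_constant_scale[of "L (bracket_l S \<epsilon> f g) v" "{..<d}"] by simp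
  also have "\<dots> = lin_ext scl (\<lambda>a. lin_ext scl (\<lambda>b. \<Sum>j<d. rho_bracket v ((W ^^ j) a) b) g) f"
    by (simp only: M.lin_ext_sum_fun)
  also have "\<dots> = lin_ext scl (\<lambda>a. lin_ext scl
      (\<lambda>b. \<rho> (snd a) (\<rho> (snd b) v) - \<rho> (snd b) (\<rho> (snd a) v)) g) f"
    by (intro lin_ext_cong sum_rho_bracket free_space_keys[OF f(1)] free_space_keys[OF g])
  \<comment> \<open>In the subtracted term the order of extension is exchanged, so that the
    operators of \<open>g\<close> stand outside those of \<open>f\<close>.\<close>
  also have "\<dots> = lin_ext scl (\<lambda>a. lin_ext scl (\<lambda>b. \<rho> (snd a) (\<rho> (snd b) v)) g) f
      - lin_ext scl (\<lambda>b. lin_ext scl (\<lambda>a. \<rho> (snd b) (\<rho> (snd a) v)) f) g"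
    unfolding M.lin_ext_diff_fun by (subst (2) M.lin_ext_swap) (rule refl)
  also have "lin_ext scl (\<lambda>a. lin_ext scl (\<lambda>b. \<rho> (snd a) (\<rho> (snd b) v)) g) f = L f (L g v)"
    unfolding L_def using free_space_keys[OF f(1)]
    by (intro lin_ext_cong module_hom_apply_lin_ext[OF rho_module_hom, symmetric]) (simp add: tilde_roots_iff)
  also have "lin_ext scl (\<lambda>b. lin_ext scl (\<lambda>a. \<rho> (snd b) (\<rho> (snd a) v)) f) g = L g (L f v)"
    unfolding L_def using free_space_keys[OF g]
    by (intro lin_ext_cong module_hom_apply_lin_ext[OF rho_module_hom, symmetric]) (simp add: tilde_roots_iff)
  finally show ?thesis .
qed

lemma bracket_closed: "x \<in> carrier \<gg> \<Longrightarrow> y \<in> carrier \<gg> \<Longrightarrow> bracket \<gg> x y \<in> carrier \<gg>"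
  and rho_tilde_bracket: "x \<in> carrier \<gg> \<Longrightarrow> y \<in> carrier \<gg> \<Longrightarrow>
    rho_tilde (bracket \<gg> x y) v = rho_tilde x (rho_tilde y v) - rho_tilde y (rho_tilde x v)"
proof -
  assume x: "x \<in> carrier \<gg>" and y: "y \<in> carrier \<gg>"
  from x obtain f where f: "f \<in> free_space S" "push_forward W f - f \<in> R" "lrep (snd x) = f"
    "x = (\<lambda>_. 0, lclass S f)" by (rule g_carrierE)
  from y obtain g where g: "g \<in> free_space S" "push_forward W g - g \<in> R" "lrep (snd y) = g"
    "y = (\<lambda>_. 0, lclass S g)" by (rule g_carrierE)
  have "lrep (lclass S f) = f" "lrep (lclass S g) = g" using f g by auto
  note br = g_bracket[OF f(1,2) this(1) g(1,2) this(2)]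
  show "bracket \<gg> x y \<in> carrier \<gg>"
    unfolding f(4) g(4) br(1) by (intro g_carrierI br)
  \<comment> \<open>The factor 1/d occurs once in the image of the bracket but twice in the
    commutator of the images. The factor d in \<open>L_bracket\<close> makes up the
    difference.\<close>
  define c :: 'k where "c = 1 / of_nat d"
  have d: "c * of_nat d = 1" using order_pos by (simp add: c_def)
  have lin: "L f (scl c u) = scl c (L f u)" "L g (scl c u) = scl c (L g u)" for u
    using L_linear[OF f(1)] L_linear[OF g(1)] by (simp_all add: Vector_Spaces.linear_iff)
  have "L (bracket_l S \<epsilon> f g) v = scl (c * of_nat d) (L (bracket_l S \<epsilon> f g) v)"
    by (simp only: d emb_simps V.scale_one)
  also have "\<dots> = scl c (scl (of_nat d) (L (bracket_l S \<epsilon> f g) v))"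
    by (simp only: emb_simps V.scale_scale)
  also have "\<dots> = scl c (L f (L g v) - L g (L f v))"
    by (simp only: L_bracket[OF f(1,2) g(1)])
  finally show "rho_tilde (bracket \<gg> x y) v = rho_tilde x (rho_tilde y v) - rho_tilde y (rho_tilde x v)"
    unfolding f(4) g(4) br(1) rho_tilde_lclass c_def[symmetric]
    by (simp add: L_fscale lin V.scale_right_diff_distrib)
qed

lemma lie_hom_rho_tilde_map:
  assumes r: "rho_tilde_map S \<epsilon> e s \<rho> r"
  shows "lie_hom \<gg> (gl_alg e s) r"
proof -
  have "r (bracket \<gg> x y) = bracket (gl_alg e s) (r x) (r y)"
    if "x \<in> carrier \<gg>" "y \<in> carrier \<gg>" for x y
    using that rho_tilde_bracket[OF that]
    by (simp add: rho_tilde_map_unique[OF r] bracket_closed gl_alg_def fun_eq_iff)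
  then show ?thesis using r by (simp add: lie_hom_def rho_tilde_map_def)
qed

lemma ex1_rho_tilde_map: "\<exists>!r. rho_tilde_map S \<epsilon> e s \<rho> r"
proof (rule ex1I[of _ "restrict rho_tilde (carrier \<gg>)"])
  fix r assume r: "rho_tilde_map S \<epsilon> e s \<rho> r"
  then have "r \<in> extensional (carrier \<gg>)" by (simp add: rho_tilde_map_def)
  then show "r = restrict rho_tilde (carrier \<gg>)"
    using rho_tilde_map_unique[OF r] by (intro extensionalityI[of _ "carrier \<gg>"]) auto
qed (rule rho_tilde_map_restrict)

end

theorem theorem4p4:
  fixes S :: "('l::ab_group_add, 'k::field_char_0, 'h) setup_data"
    and e :: "'k \<Rightarrow> 'K::field"
    and s :: "'K \<Rightarrow> 'v::ab_group_add \<Rightarrow> 'v"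
    and \<rho> :: "'h \<Rightarrow> 'v \<Rightarrow> 'v"
  assumes "input_datum S (eps_w S)"
    and "\<forall>\<alpha> \<beta>. lattice_pairing S \<alpha> \<beta> = pairing_w S \<alpha> \<beta>"
    and "field_embedding e"
    and "vector_space s"
    and "\<rho> \<in> hom (extgrp S) (general_linear_group s)"
    and "\<forall>v. \<rho> (incl S (zeta S)) v = s (e (zeta S)) v"
  shows "(\<exists>!r. rho_tilde_map S (eps_w S) e s \<rho> r) \<and>
         (\<forall>r. rho_tilde_map S (eps_w S) e s \<rho> r \<longrightarrow> lie_hom (g_alg S (eps_w S)) (gl_alg e s) r)"
proof -
  have "rep_datum S e s \<rho>"
    using assms
    by (intro rep_datum.intro special_datum.intro elliptic_setting.intro special_datum_axioms.intro
          rep_datum_axioms.intro)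
       (auto simp: input_datum_def)
  then interpret rep_datum S e s \<rho> .
  show ?thesis using ex1_rho_tilde_map lie_hom_rho_tilde_map by blast
qed

end
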